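(* Let $T$ be a Lie triple system and $(V,\theta)$ a representation of $T$ (a $T$-module). Then there is a one-to-one correspondence between equivalence classes of abelian extensions of the Lie triple system $T$ by $V$ and the cohomology group $\mathbf{H}^3(T,V)$.
   Context: All Lie triple systems are over an algebraically closed field of characteristic different from 2 and 3. A Lie triple system is a vector space $T$ with a trilinear map $[\cdot,\cdot,\cdot]:T\times T\times T\to T$ such that, for all elements, $[x_1,x_1,x_2]=0$; $[x_1,x_2,x_3]+[x_2,x_3,x_1]+[x_3,x_1,x_2]=0$; and $[x_1,x_2,[y_1,y_2,y_3]]=[[x_1,x_2,y_1],y_2,y_3]+[y_1,[x_1,x_2,y_2],y_3]+[y_1,y_2,[x_1,x_2,y_3]]$. Homomorphisms are linear maps preserving the ternary bracket. A representation $(V,\theta)$ of $T$ is a vector space $V$ with a linear map $\theta:T\otimes T\to\mathrm{End}(V)$ such that, with $D(x_1,x_2):=\theta(x_2,x_1)-\theta(x_1,x_2)$: (R1) $[D(x_1,x_2),\theta(y_1,y_2)]=\theta([x_1,x_2,y_1],y_2)+\theta(y_1,[x_1,x_2,y_2])$ (commutator on the left); (R2) $\theta(x_1,[y_1,y_2,y_3])=\theta(y_2,y_3)\theta(x_1,y_1)-\theta(y_1,y_3)\theta(x_1,y_2)+D(y_1,y_2)\theta(x_1,y_3)$. An extension of $T$ by $V$ is a short exact sequence $0\to V\xrightarrow{i}\hat{T}\xrightarrow{p}T\to0$ of Lie triple systems and homomorphisms. It is an abelian extension if $V$ (identified with $i(V)$) is an abelian ideal of $\hat{T}$, i.e. $[u,v,\cdot]_{\hat{T}}=[u,\cdot,v]_{\hat{T}}=[\cdot,u,v]_{\hat{T}}=0$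 for all $u,v\in V$. Two extensions $0\to V\xrightarrow{i}\hat{T}\xrightarrow{p}T\to0$ and $0\to V\xrightarrow{j}\tilde{T}\xrightarrow{q}T\to0$ are equivalent if there is a Lie triple system homomorphism $F:\hat{T}\to\tilde{T}$ with $F\circ i=j$ and $q\circ F=p$. $\mathbf{H}^3(T,V)$ is the quotient of the space of 3-cocycles by the space of 3-coboundaries. A 3-cocycle is a trilinear map $\omega:T\times T\times T\to V$ such that, for all elements, $\omega(x_1,x_1,x_2)=0$; $\omega(x_1,x_2,x_3)+\omega(x_2,x_3,x_1)+\omega(x_3,x_1,x_2)=0$; and $$\begin{aligned}&\omega(x_1,x_2,[y_1,y_2,y_3])+D(x_1,x_2)\omega(y_1,y_2,y_3)\\&=\omega([x_1,x_2,y_1],y_2,y_3)+\omega(y_1,[x_1,x_2,y_2],y_3)+\omega(y_1,y_2,[x_1,x_2,y_3])\\&\quad+\theta(y_2,y_3)\omega(x_1,x_2,y_1)-\theta(y_1,y_3)\omega(x_1,x_2,y_2)+D(y_1,y_2)\omega(x_1,x_2,y_3).\end{aligned}$$ A 3-coboundary is a map of the form $d\nu$ for a linear map $\nu:T\to V$, where $d\nu(x_1,x_2,x_3)=D(x_1,x_2)\nu(x_3)-\theta(x_1,x_3)\nu(x_2)+\theta(x_2,x_3)\nu(x_1)-\nu([x_1,x_2,x_3])$.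
   Formalization: The abelian extensions are taken to be those inducing the given module structure, [v,a,b] = θ(p(a),p(b))v for v in V; without this the claim fails (e.g. T, V one-dimensional with T of zero bracket: the cohomology is 0 but there are infinitely many classes). *)

theory Defs
  imports "HOL-Algebra.Algebra"
begin

definition ring_characteristic :: "('a, 'm) ring_scheme \<Rightarrow> nat" where
  "ring_characteristic R =
     (if \<exists>n::nat. n > 0 \<and> [n] \<cdot>\<^bsub>R\<^esub> \<one>\<^bsub>R\<^esub> = \<zero>\<^bsub>R\<^esub>
      then (LEAST n::nat. n > 0 \<and> [n] \<cdot>\<^bsub>R\<^esub> \<one>\<^bsub>R\<^esub> = \<zero>\<^bsub>R\<^esub>) else 0)"


section \<open>Linear and trilinear maps\<close>

text \<open>As everywhere below, maps are constrained only on the carriers.\<close>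

definition linear_maps ::
  "('k, 'm) ring_scheme \<Rightarrow> ('k, 'a, 'p) module_scheme \<Rightarrow> ('k, 'b, 'q) module_scheme \<Rightarrow> ('a \<Rightarrow> 'b) set"
  where
  "linear_maps K M N =
     {f \<in> carrier M \<rightarrow> carrier N.
        (\<forall>x\<in>carrier M. \<forall>y\<in>carrier M. f (x \<oplus>\<^bsub>M\<^esub> y) = f x \<oplus>\<^bsub>N\<^esub> f y) \<and>
        (\<forall>a\<in>carrier K. \<forall>x\<in>carrier M. f (a \<odot>\<^bsub>M\<^esub> x) = a \<odot>\<^bsub>N\<^esub> f x)}"

definition trilinear_maps ::
  "('k, 'm) ring_scheme \<Rightarrow> ('k, 'a, 'p) module_scheme \<Rightarrow> ('k, 'b, 'q) module_scheme \<Rightarrow>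
   ('k, 'c, 'r) module_scheme \<Rightarrow> ('k, 'd, 's) module_scheme \<Rightarrow> ('a \<Rightarrow> 'b \<Rightarrow> 'c \<Rightarrow> 'd) set"
  where
  "trilinear_maps K A B C N =
     {f. (\<forall>y\<in>carrier B. \<forall>z\<in>carrier C. (\<lambda>x. f x y z) \<in> linear_maps K A N) \<and>
         (\<forall>x\<in>carrier A. \<forall>z\<in>carrier C. (\<lambda>y. f x y z) \<in> linear_maps K B N) \<and>
         (\<forall>x\<in>carrier A. \<forall>y\<in>carrier B. (\<lambda>z. f x y z) \<in> linear_maps K C N)}"


section \<open>Lie triple systems\<close>

text \<open>The fields \<open>mult\<close> and \<open>one\<close> inherited through \<open>module\<close> play no role.\<close>

record ('k, 't) lts = "('k, 't) module" +
  tbracket :: "'t \<Rightarrow> 't \<Rightarrow> 't \<Rightarrow> 't"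

locale lie_triple_system = module K T
  for K (structure) and T :: "('k, 't, 'n) lts_scheme" (structure) +
  assumes tbracket_trilinear: "tbracket T \<in> trilinear_maps K T T T T"
    and tbracket_alt:
      "\<lbrakk>x1 \<in> carrier T; x2 \<in> carrier T\<rbrakk> \<Longrightarrow> tbracket T x1 x1 x2 = \<zero>\<^bsub>T\<^esub>"
    and tbracket_cyclic:
      "\<lbrakk>x1 \<in> carrier T; x2 \<in> carrier T; x3 \<in> carrier T\<rbrakk> \<Longrightarrow>
        tbracket T x1 x2 x3 \<oplus>\<^bsub>T\<^esub> tbracket T x2 x3 x1 \<oplus>\<^bsub>T\<^esub> tbracket T x3 x1 x2 = \<zero>\<^bsub>T\<^esub>"
    and tbracket_derivation:
      "\<lbrakk>x1 \<in> carrier T; x2 \<in> carrier T; y1 \<in> carrier T; y2 \<in> carrier T; y3 \<in> carrier T\<rbrakk> \<Longrightarrow>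
        tbracket T x1 x2 (tbracket T y1 y2 y3) =
          tbracket T (tbracket T x1 x2 y1) y2 y3 \<oplus>\<^bsub>T\<^esub>
          tbracket T y1 (tbracket T x1 x2 y2) y3 \<oplus>\<^bsub>T\<^esub>
          tbracket T y1 y2 (tbracket T x1 x2 y3)"

definition lts_hom ::
  "('k, 'm) ring_scheme \<Rightarrow> ('k, 'a, 'p) lts_scheme \<Rightarrow> ('k, 'b, 'q) lts_scheme \<Rightarrow> ('a \<Rightarrow> 'b) set"
  where
  "lts_hom K A B =
     {f \<in> linear_maps K A B.
        \<forall>x\<in>carrier A. \<forall>y\<in>carrier A. \<forall>z\<in>carrier A.
          f (tbracket A x y z) = tbracket B (f x) (f y) (f z)}"


section \<open>Representations\<close>

definition rep_D ::
  "('k, 'v, 'l) module_scheme \<Rightarrow> ('t \<Rightarrow> 't \<Rightarrow> 'v \<Rightarrow> 'v) \<Rightarrow> 't \<Rightarrow> 't \<Rightarrow> 'v \<Rightarrow> 'v" where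
  "rep_D V \<theta> x1 x2 v = \<theta> x2 x1 v \<ominus>\<^bsub>V\<^esub> \<theta> x1 x2 v"

text \<open>A linear map from \<open>T \<otimes> T\<close> to \<open>End(V)\<close> is encoded as a trilinear map
  \<open>(x, y, v) \<mapsto> \<theta>(x,y)v\<close>; the operator identities are stated pointwise on \<open>V\<close>.\<close>

locale lts_representation = lie_triple_system K T + V: module K V
  for K (structure) and T :: "('k, 't, 'n) lts_scheme" (structure)
    and V :: "('k, 'v, 'l) module_scheme" and \<theta> :: "'t \<Rightarrow> 't \<Rightarrow> 'v \<Rightarrow> 'v" +
  assumes rep_trilinear: "\<theta> \<in> trilinear_maps K T T V V"
    and rep_R1:
      "\<lbrakk>x1 \<in> carrier T; x2 \<in> carrier T; y1 \<in> carrier T; y2 \<in> carrier T; v \<in> carrier V\<rbrakk> \<Longrightarrow>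
        rep_D V \<theta> x1 x2 (\<theta> y1 y2 v) \<ominus>\<^bsub>V\<^esub> \<theta> y1 y2 (rep_D V \<theta> x1 x2 v) =
          \<theta> (tbracket T x1 x2 y1) y2 v \<oplus>\<^bsub>V\<^esub> \<theta> y1 (tbracket T x1 x2 y2) v"
    and rep_R2:
      "\<lbrakk>x1 \<in> carrier T; y1 \<in> carrier T; y2 \<in> carrier T; y3 \<in> carrier T; v \<in> carrier V\<rbrakk> \<Longrightarrow>
        \<theta> x1 (tbracket T y1 y2 y3) v =
          \<theta> y2 y3 (\<theta> x1 y1 v) \<ominus>\<^bsub>V\<^esub> \<theta> y1 y3 (\<theta> x1 y2 v) \<oplus>\<^bsub>V\<^esub> rep_D V \<theta> y1 y2 (\<theta> x1 y3 v)"


section \<open>Third cohomology group\<close>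

text \<open>A trilinear map \<open>\<omega>\<close> on \<open>T\<close> is represented by a unique HOL function by letting it take the
  value \<open>\<zero>\<close> as soon as one of the arguments lies outside the carrier; likewise for \<open>d\<nu>\<close>.\<close>

definition cocycles3 ::
  "('k, 'm) ring_scheme \<Rightarrow> ('k, 't, 'n) lts_scheme \<Rightarrow> ('k, 'v, 'l) module_scheme \<Rightarrow>
   ('t \<Rightarrow> 't \<Rightarrow> 'v \<Rightarrow> 'v) \<Rightarrow> ('t \<Rightarrow> 't \<Rightarrow> 't \<Rightarrow> 'v) set" where
  "cocycles3 K T V \<theta> =
     {\<omega> \<in> trilinear_maps K T T T V.
        (\<forall>x1 x2 x3. \<not> (x1 \<in> carrier T \<and> x2 \<in> carrier T \<and> x3 \<in> carrier T) \<longrightarrow> \<omega> x1 x2 x3 = \<zero>\<^bsub>V\<^esub>) \<and>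
        (\<forall>x1\<in>carrier T. \<forall>x2\<in>carrier T. \<omega> x1 x1 x2 = \<zero>\<^bsub>V\<^esub>) \<and>
        (\<forall>x1\<in>carrier T. \<forall>x2\<in>carrier T. \<forall>x3\<in>carrier T.
           \<omega> x1 x2 x3 \<oplus>\<^bsub>V\<^esub> \<omega> x2 x3 x1 \<oplus>\<^bsub>V\<^esub> \<omega> x3 x1 x2 = \<zero>\<^bsub>V\<^esub>) \<and>
        (\<forall>x1\<in>carrier T. \<forall>x2\<in>carrier T.
         \<forall>y1\<in>carrier T. \<forall>y2\<in>carrier T. \<forall>y3\<in>carrier T.
           \<omega> x1 x2 (tbracket T y1 y2 y3) \<oplus>\<^bsub>V\<^esub> rep_D V \<theta> x1 x2 (\<omega> y1 y2 y3) =
             \<omega> (tbracket T x1 x2 y1) y2 y3 \<oplus>\<^bsub>V\<^esub>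
             \<omega> y1 (tbracket T x1 x2 y2) y3 \<oplus>\<^bsub>V\<^esub>
             \<omega> y1 y2 (tbracket T x1 x2 y3) \<oplus>\<^bsub>V\<^esub>
             \<theta> y2 y3 (\<omega> x1 x2 y1) \<ominus>\<^bsub>V\<^esub>
             \<theta> y1 y3 (\<omega> x1 x2 y2) \<oplus>\<^bsub>V\<^esub>
             rep_D V \<theta> y1 y2 (\<omega> x1 x2 y3))}"

definition coboundary ::
  "('k, 't, 'n) lts_scheme \<Rightarrow> ('k, 'v, 'l) module_scheme \<Rightarrow>
   ('t \<Rightarrow> 't \<Rightarrow> 'v \<Rightarrow> 'v) \<Rightarrow> ('t \<Rightarrow> 'v) \<Rightarrow> 't \<Rightarrow> 't \<Rightarrow> 't \<Rightarrow> 'v" where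
  "coboundary T V \<theta> \<nu> x1 x2 x3 =
     (if x1 \<in> carrier T \<and> x2 \<in> carrier T \<and> x3 \<in> carrier T
      then rep_D V \<theta> x1 x2 (\<nu> x3) \<ominus>\<^bsub>V\<^esub> \<theta> x1 x3 (\<nu> x2) \<oplus>\<^bsub>V\<^esub> \<theta> x2 x3 (\<nu> x1)
             \<ominus>\<^bsub>V\<^esub> \<nu> (tbracket T x1 x2 x3)
      else \<zero>\<^bsub>V\<^esub>)"

definition coboundaries3 ::
  "('k, 'm) ring_scheme \<Rightarrow> ('k, 't, 'n) lts_scheme \<Rightarrow> ('k, 'v, 'l) module_scheme \<Rightarrow>
   ('t \<Rightarrow> 't \<Rightarrow> 'v \<Rightarrow> 'v) \<Rightarrow> ('t \<Rightarrow> 't \<Rightarrow> 't \<Rightarrow> 'v) set" where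
  "coboundaries3 K T V \<theta> = coboundary T V \<theta> ` linear_maps K T V"

definition cocycle_group ::
  "('k, 'm) ring_scheme \<Rightarrow> ('k, 't, 'n) lts_scheme \<Rightarrow> ('k, 'v, 'l) module_scheme \<Rightarrow>
   ('t \<Rightarrow> 't \<Rightarrow> 'v \<Rightarrow> 'v) \<Rightarrow> ('t \<Rightarrow> 't \<Rightarrow> 't \<Rightarrow> 'v) monoid" where
  "cocycle_group K T V \<theta> =
     \<lparr>carrier = cocycles3 K T V \<theta>,
      monoid.mult = (\<lambda>\<omega> \<omega>' x1 x2 x3. \<omega> x1 x2 x3 \<oplus>\<^bsub>V\<^esub> \<omega>' x1 x2 x3),
      one = (\<lambda>_ _ _. \<zero>\<^bsub>V\<^esub>)\<rparr>"

definition cohomology3 ::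
  "('k, 'm) ring_scheme \<Rightarrow> ('k, 't, 'n) lts_scheme \<Rightarrow> ('k, 'v, 'l) module_scheme \<Rightarrow>
   ('t \<Rightarrow> 't \<Rightarrow> 'v \<Rightarrow> 'v) \<Rightarrow> ('t \<Rightarrow> 't \<Rightarrow> 't \<Rightarrow> 'v) set monoid" where
  "cohomology3 K T V \<theta> = cocycle_group K T V \<theta> Mod coboundaries3 K T V \<theta>"


section \<open>Abelian extensions\<close>

definition lts_extension ::
  "('k, 'm) ring_scheme \<Rightarrow> ('k, 'w, 'l) lts_scheme \<Rightarrow> ('k, 'e, 'p) lts_scheme \<Rightarrow>
   ('k, 't, 'n) lts_scheme \<Rightarrow> ('w \<Rightarrow> 'e) \<Rightarrow> ('e \<Rightarrow> 't) \<Rightarrow> bool" where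
  "lts_extension K W E T i p \<longleftrightarrow>
     lie_triple_system K W \<and> lie_triple_system K E \<and> lie_triple_system K T \<and>
     i \<in> lts_hom K W E \<and> p \<in> lts_hom K E T \<and>
     inj_on i (carrier W) \<and>
     i ` carrier W = {x \<in> carrier E. p x = \<zero>\<^bsub>T\<^esub>} \<and>
     p ` carrier E = carrier T"

text \<open>In an abelian extension the bracket of the kernel vanishes, so the vector space \<open>V\<close> enters
  the exact sequence as a Lie triple system with zero bracket.\<close>

definition zero_bracket_lts :: "('k, 'v, 'l) module_scheme \<Rightarrow> ('k, 'v) lts" where
  "zero_bracket_lts V =
     \<lparr>carrier = carrier V, monoid.mult = monoid.mult V, one = \<one>\<^bsub>V\<^esub>,
      ring.zero = \<zero>\<^bsub>V\<^esub>, ring.add = ring.add V, smult = smult V, tbracket = (\<lambda>_ _ _. \<zero>\<^bsub>V\<^esub>)\<rparr>"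

text \<open>The last condition says that the \<open>T\<close>-module structure which the extension induces on \<open>V\<close>,
  \<open>\<theta>(x,y)v = [v, \<sigma> x, \<sigma> y]\<close> for a section \<open>\<sigma>\<close> of \<open>p\<close>, is the given one; it is written with arbitrary
  lifts of \<open>x\<close> and \<open>y\<close>, so that no section has to be chosen.  That \<open>i ` carrier V\<close> is an ideal is
  automatic, since it is the kernel of \<open>p\<close>.\<close>

definition abelian_extensions ::
  "('k, 'm) ring_scheme \<Rightarrow> ('k, 't, 'n) lts_scheme \<Rightarrow> ('k, 'v, 'l) module_scheme \<Rightarrow>
   ('t \<Rightarrow> 't \<Rightarrow> 'v \<Rightarrow> 'v) \<Rightarrow> (('k, 'e) lts \<times> ('v \<Rightarrow> 'e) \<times> ('e \<Rightarrow> 't)) set" where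
  "abelian_extensions K T V \<theta> =
     {(E, i, p).
        lts_extension K (zero_bracket_lts V) E T i p \<and>
        (\<forall>u\<in>i ` carrier V. \<forall>v\<in>i ` carrier V. \<forall>x\<in>carrier E.
           tbracket E u v x = \<zero>\<^bsub>E\<^esub> \<and> tbracket E u x v = \<zero>\<^bsub>E\<^esub> \<and> tbracket E x u v = \<zero>\<^bsub>E\<^esub>) \<and>
        (\<forall>v\<in>carrier V. \<forall>a\<in>carrier E. \<forall>b\<in>carrier E.
           tbracket E (i v) a b = i (\<theta> (p a) (p b) v))}"

definition extension_equiv ::
  "('k, 'm) ring_scheme \<Rightarrow> ('k, 't, 'n) lts_scheme \<Rightarrow> ('k, 'v, 'l) module_scheme \<Rightarrow>
   ('t \<Rightarrow> 't \<Rightarrow> 'v \<Rightarrow> 'v) \<Rightarrow>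
   ((('k, 'e) lts \<times> ('v \<Rightarrow> 'e) \<times> ('e \<Rightarrow> 't)) \<times> (('k, 'e) lts \<times> ('v \<Rightarrow> 'e) \<times> ('e \<Rightarrow> 't))) set" where
  "extension_equiv K T V \<theta> =
     {((E, i, p), (E', j, q)).
        (E, i, p) \<in> abelian_extensions K T V \<theta> \<and> (E', j, q) \<in> abelian_extensions K T V \<theta> \<and>
        (\<exists>F \<in> lts_hom K E E'.
           (\<forall>v\<in>carrier V. F (i v) = j v) \<and> (\<forall>x\<in>carrier E. q (F x) = p x))}"

definition linear_sections ::
  "('k, 'm) ring_scheme \<Rightarrow> ('k, 't, 'n) lts_scheme \<Rightarrow> ('k, 'e, 'p) lts_scheme \<Rightarrow> ('e \<Rightarrow> 't) \<Rightarrow>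
   ('t \<Rightarrow> 'e) set" where
  "linear_sections K T E p = {\<sigma> \<in> linear_maps K T E. \<forall>x\<in>carrier T. p (\<sigma> x) = x}"

definition extension_cocycle ::
  "('k, 't, 'n) lts_scheme \<Rightarrow> ('k, 'v, 'l) module_scheme \<Rightarrow> ('k, 'e, 'p) lts_scheme \<Rightarrow> ('v \<Rightarrow> 'e) \<Rightarrow>
   ('t \<Rightarrow> 'e) \<Rightarrow> 't \<Rightarrow> 't \<Rightarrow> 't \<Rightarrow> 'v" where
  "extension_cocycle T V E i \<sigma> x1 x2 x3 =
     (if x1 \<in> carrier T \<and> x2 \<in> carrier T \<and> x3 \<in> carrier T
      then inv_into (carrier V) i
             (tbracket E (\<sigma> x1) (\<sigma> x2) (\<sigma> x3) \<ominus>\<^bsub>E\<^esub> \<sigma> (tbracket T x1 x2 x3))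
      else \<zero>\<^bsub>V\<^esub>)"

end

theory Submission
  imports Defs
begin

text \<open>
  Every surjective linear map \<open>p\<close> onto \<open>T\<close> has a linear section \<open>\<sigma>\<close>: invert \<open>p\<close> on a
  complement of its kernel, which exists by Zorn's lemma.  A section identifies an abelian
  extension with \<open>V \<times> T\<close>, and under this identification the bracket is that of the
  semidirect product plus \<open>\<omega>(x\<^sub>1,x\<^sub>2,x\<^sub>3) = [\<sigma>x\<^sub>1,\<sigma>x\<^sub>2,\<sigma>x\<^sub>3] - \<sigma>[x\<^sub>1,x\<^sub>2,x\<^sub>3]\<close>.  Comparing \<open>V\<close>-components
  turns the axioms of a Lie triple system into the cocycle conditions and back.  Replacing \<open>\<sigma>\<close> by
  \<open>\<sigma> + i\<nu>\<close> adds \<open>d\<nu>\<close> to \<open>\<omega>\<close>, and a morphism of extensions carries sections to sections with the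
  same cocycle, so two extensions are equivalent iff their cocycles are cohomologous.
\<close>

section \<open>Linear maps\<close>

text \<open>Computations take place inside the extension itself: \<open>emb u x\<close>, that is
  \<open>i u + \<sigma> x\<close>, serves as a system of coordinates, and uniqueness of coordinates
  turns an equation in \<open>E\<close> into one in \<open>V\<close> and one in \<open>T\<close>.
  The expression \<open>semidirect_bracket\<close> then has three roles: it is the
  \<open>V\<close>-part of a bracket in coordinates up to the cocycle, it gives the coboundary when
  evaluated on the graph of \<open>\<nu>\<close>, and it is the source of the
  \<open>\<theta>\<close> and \<open>D\<close> terms in the cocycle identity.

  Two obstacles shape the rest. An equivalence of extensions is only a morphism in one direction;
  that the relation is symmetric and transitive is read off from its coincidence with equality of
  cosets, and the quotient is then treated as the set of fibres of a map. Moreover, all extensions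
  have to live on the one type \<open>'e\<close>, whereas a cocycle yields an extension on pairs.
  That extension is carried into \<open>'e\<close> along the injection \<open>g\<close>, which is a
  morphism of extensions onto the copy and therefore keeps the cocycle.\<close>

lemma linear_mapsI:
  assumes "\<And>x. x \<in> carrier M \<Longrightarrow> f x \<in> carrier N"
    and "\<And>x y. x \<in> carrier M \<Longrightarrow> y \<in> carrier M \<Longrightarrow> f (x \<oplus>\<^bsub>M\<^esub> y) = f x \<oplus>\<^bsub>N\<^esub> f y"
    and "\<And>a x. a \<in> carrier K \<Longrightarrow> x \<in> carrier M \<Longrightarrow> f (a \<odot>\<^bsub>M\<^esub> x) = a \<odot>\<^bsub>N\<^esub> f x"
  shows "f \<in> linear_maps K M N"
  using assms by (auto simp: linear_maps_def)

lemma linear_maps_closed: "f \<in> linear_maps K M N \<Longrightarrow> x \<in> carrier M \<Longrightarrow> f x \<in> carrier N"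
  by (auto simp: linear_maps_def)

lemma linear_maps_add:
  "f \<in> linear_maps K M N \<Longrightarrow> x \<in> carrier M \<Longrightarrow> y \<in> carrier M \<Longrightarrow> f (x \<oplus>\<^bsub>M\<^esub> y) = f x \<oplus>\<^bsub>N\<^esub> f y"
  by (auto simp: linear_maps_def)

lemma linear_maps_smult:
  "f \<in> linear_maps K M N \<Longrightarrow> a \<in> carrier K \<Longrightarrow> x \<in> carrier M \<Longrightarrow> f (a \<odot>\<^bsub>M\<^esub> x) = a \<odot>\<^bsub>N\<^esub> f x"
  by (auto simp: linear_maps_def)

lemma linear_maps_zero:
  assumes "abelian_group M" "abelian_group N" "f \<in> linear_maps K M N"
  shows "f \<zero>\<^bsub>M\<^esub> = \<zero>\<^bsub>N\<^esub>"
proof -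
  interpret M: abelian_group M by fact
  interpret N: abelian_group N by fact
  have "f \<zero>\<^bsub>M\<^esub> \<oplus>\<^bsub>N\<^esub> f \<zero>\<^bsub>M\<^esub> = f \<zero>\<^bsub>M\<^esub>"
    using linear_maps_add[OF assms(3), of "\<zero>\<^bsub>M\<^esub>" "\<zero>\<^bsub>M\<^esub>"] by simp
  then show ?thesis
    using linear_maps_closed[OF assms(3), of "\<zero>\<^bsub>M\<^esub>"] by (simp add: N.add.r_cancel_one)
qed

lemma linear_maps_minus:
  assumes "abelian_group M" "abelian_group N" "f \<in> linear_maps K M N" "x \<in> carrier M"
  shows "f (\<ominus>\<^bsub>M\<^esub> x) = \<ominus>\<^bsub>N\<^esub> f x"
proof -
  interpret M: abelian_group M by fact
  interpret N: abelian_group N by fact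
  have "f (\<ominus>\<^bsub>M\<^esub> x) \<oplus>\<^bsub>N\<^esub> f x = \<zero>\<^bsub>N\<^esub>"
    using linear_maps_add[OF assms(3), of "\<ominus>\<^bsub>M\<^esub> x" x] linear_maps_zero[OF assms(1-3)] assms(4)
    by (simp add: M.l_neg)
  then show ?thesis
    using assms(4) linear_maps_closed[OF assms(3)] by (metis M.a_inv_closed N.minus_equality)
qed

lemma linear_maps_diff:
  assumes "abelian_group M" "abelian_group N" "f \<in> linear_maps K M N"
    and "x \<in> carrier M" "y \<in> carrier M"
  shows "f (x \<ominus>\<^bsub>M\<^esub> y) = f x \<ominus>\<^bsub>N\<^esub> f y"
  using assms abelian_group.a_inv_closed[OF assms(1)]
  by (simp add: a_minus_def linear_maps_add linear_maps_minus)

lemma linear_maps_compose: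
  assumes "f \<in> linear_maps K L M" "h \<in> linear_maps K M N"
  shows "(\<lambda>x. h (f x)) \<in> linear_maps K L N"
  by (rule linear_mapsI)
    (simp_all add: linear_maps_closed[OF assms(1)] linear_maps_closed[OF assms(2)]
      linear_maps_add[OF assms(1)] linear_maps_add[OF assms(2)]
      linear_maps_smult[OF assms(1)] linear_maps_smult[OF assms(2)])

lemma (in abelian_group) add4:
  "\<lbrakk> a \<in> carrier G; b \<in> carrier G; c \<in> carrier G; d \<in> carrier G\<rbrakk> \<Longrightarrow>
   (a \<oplus> b) \<oplus> (c \<oplus> d) = (a \<oplus> c) \<oplus> (b \<oplus> d)"
  by (simp add: a_ac)

lemma (in abelian_group) a_inv_zero: "\<ominus> \<zero> = \<zero>"
  by (rule minus_equality) simp_all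

lemma (in abelian_group) minus_self: "a \<in> carrier G \<Longrightarrow> a \<ominus> a = \<zero>"
  by (simp add: a_minus_def r_neg)

lemma (in abelian_group) add_minus_cancel: "\<lbrakk>a \<in> carrier G; b \<in> carrier G\<rbrakk> \<Longrightarrow> a \<oplus> (b \<ominus> a) = b"
  by (simp add: a_minus_def a_lcomm[of a b] r_neg)

lemma linear_maps_sum:
  assumes "module K M" "module K N" "f \<in> linear_maps K M N" "h \<in> linear_maps K M N"
  shows "(\<lambda>x. f x \<oplus>\<^bsub>N\<^esub> h x) \<in> linear_maps K M N"
proof -
  interpret M: module K M by fact
  interpret N: module K N by fact
  note [simp] = linear_maps_closed[OF assms(3)] linear_maps_closed[OF assms(4)]
    linear_maps_add[OF assms(3)] linear_maps_add[OF assms(4)]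
    linear_maps_smult[OF assms(3)] linear_maps_smult[OF assms(4)]
  show ?thesis
    by (rule linear_mapsI) (simp_all add: N.M.add4 N.smult_r_distr)
qed

lemma linear_maps_uminus:
  assumes "module K M" "module K N" "f \<in> linear_maps K M N"
  shows "(\<lambda>x. \<ominus>\<^bsub>N\<^esub> f x) \<in> linear_maps K M N"
proof -
  interpret M: module K M by fact
  interpret N: module K N by fact
  note [simp] = linear_maps_closed[OF assms(3)]
    linear_maps_add[OF assms(3)] linear_maps_smult[OF assms(3)]
  show ?thesis
    by (rule linear_mapsI) (simp_all add: N.M.minus_add N.smult_r_minus)
qed

text \<open>The choice in \<open>inv_into\<close> is determined because \<open>h\<close> takes its
  values in the image of the injective \<open>f\<close>. Used twice: with \<open>f\<close> the
  restriction of \<open>p\<close> to a complement, to obtain a section, and with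
  \<open>f = i\<close>, to read off components in \<open>V\<close>.\<close>

lemma linear_maps_inv_into:
  assumes "module K M" "f \<in> linear_maps K M N" "inj_on f (carrier M)"
    and "h \<in> linear_maps K L N" "h ` carrier L \<subseteq> f ` carrier M"
  shows "(\<lambda>x. inv_into (carrier M) f (h x)) \<in> linear_maps K L M"
proof -
  interpret M: module K M by fact
  have cl: "inv_into (carrier M) f (h x) \<in> carrier M"
    and eq: "f (inv_into (carrier M) f (h x)) = h x" if "x \<in> carrier L" for x
    using subsetD[OF assms(5) imageI[OF that]] by (auto intro: inv_into_into f_inv_into_f)
  show ?thesis
  proof (rule linear_mapsI)
    fix x y assume "x \<in> carrier L" "y \<in> carrier L"
    then show "inv_into (carrier M) f (h (x \<oplus>\<^bsub>L\<^esub> y)) =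
       inv_into (carrier M) f (h x) \<oplus>\<^bsub>M\<^esub> inv_into (carrier M) f (h y)"
      by (intro inv_into_f_eq[OF assms(3)])
        (auto simp: cl eq linear_maps_add[OF assms(2)] linear_maps_add[OF assms(4)])
  next
    fix a x assume "a \<in> carrier K" "x \<in> carrier L"
    then show "inv_into (carrier M) f (h (a \<odot>\<^bsub>L\<^esub> x)) = a \<odot>\<^bsub>M\<^esub> inv_into (carrier M) f (h x)"
      by (intro inv_into_f_eq[OF assms(3)])
        (auto simp: cl eq linear_maps_smult[OF assms(2)] linear_maps_smult[OF assms(4)])
  qed (rule cl)
qed


section \<open>Complements and linear sections\<close>

text \<open>Let \<open>G\<close> be maximal among the submodules meeting \<open>N\<close> only in
  zero. Adjoining a vector \<open>x\<close> outside \<open>G + N\<close> would create no new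
  intersection with \<open>N\<close>, since a relation \<open>g + a x = n\<close> with
  \<open>a \<noteq> 0\<close> could be divided by \<open>a\<close> and solved for \<open>x\<close>.
  This division is the point where \<open>K\<close> enters as a field.\<close>

lemma exists_complement:
  assumes "field K" "module K M" "submodule N K M"
  shows "\<exists>G. submodule G K M \<and> G \<inter> N = {\<zero>\<^bsub>M\<^esub>} \<and>
    (\<forall>x\<in>carrier M. \<exists>g\<in>G. \<exists>n\<in>N. x = g \<oplus>\<^bsub>M\<^esub> n)"
proof -
  interpret K: field K by fact
  interpret M: module K M by fact
  interpret N: submodule N K M by fact
  note smE = M.submoduleE
  have N0: "\<zero>\<^bsub>M\<^esub> \<in> N" using N.one_closed by simp
  define \<A> where "\<A> = {G. submodule G K M \<and> G \<inter> N = {\<zero>\<^bsub>M\<^esub>}}"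
  have z: "\<zero>\<^bsub>M\<^esub> \<in> G" if "submodule G K M" for G
    using smE(2,3,5)[OF that] smE(1)[OF that] by (metis M.M.l_neg equals0I subsetD)
  have "submodule {\<zero>\<^bsub>M\<^esub>} K M" by (rule M.submoduleI) auto
  then have "\<A> \<noteq> {}" using N0 by (auto simp: \<A>_def)
  moreover have "\<Union>\<C> \<in> \<A>" if ne: "\<C> \<noteq> {}" and ch: "subset.chain \<A> \<C>" for \<C>
  proof -
    have sub: "G \<in> \<C> \<Longrightarrow> submodule G K M" and int: "G \<in> \<C> \<Longrightarrow> G \<inter> N = {\<zero>\<^bsub>M\<^esub>}" for G
      using ch by (auto simp: subset.chain_def \<A>_def)
    have tot: "G \<in> \<C> \<Longrightarrow> H \<in> \<C> \<Longrightarrow> G \<subseteq> H \<or> H \<subseteq> G" for G H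
      using ch by (auto simp: subset.chain_def)
    have "submodule (\<Union>\<C>) K M"
    proof (rule M.submoduleI)
      show "\<Union>\<C> \<subseteq> carrier M" using smE(1)[OF sub] by blast
      show "\<zero>\<^bsub>M\<^esub> \<in> \<Union>\<C>" using ne z[OF sub] by blast
      show "\<ominus>\<^bsub>M\<^esub> a \<in> \<Union>\<C>" if "a \<in> \<Union>\<C>" for a using that smE(3)[OF sub] by blast
      show "a \<odot>\<^bsub>M\<^esub> x \<in> \<Union>\<C>" if "a \<in> carrier K" "x \<in> \<Union>\<C>" for a x
        using that smE(4)[OF sub] by blast
      show "a \<oplus>\<^bsub>M\<^esub> b \<in> \<Union>\<C>" if ab: "a \<in> \<Union>\<C>" "b \<in> \<Union>\<C>" for a b
      proof -
        obtain G H where GH: "G \<in> \<C>" "H \<in> \<C>" "a \<in> G" "b \<in> H" using ab by blast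
        then show ?thesis using tot[OF GH(1,2)] smE(5)[OF sub] by blast
      qed
    qed
    moreover have "\<Union>\<C> \<inter> N = {\<zero>\<^bsub>M\<^esub>}" using ne int by auto
    ultimately show ?thesis by (simp add: \<A>_def)
  qed
  ultimately obtain G where G: "G \<in> \<A>" and max: "\<And>H. H \<in> \<A> \<Longrightarrow> G \<subseteq> H \<Longrightarrow> H = G"
    using subset_Zorn_nonempty[of \<A>] by blast
  have Gs: "submodule G K M" and GN: "G \<inter> N = {\<zero>\<^bsub>M\<^esub>}" using G by (auto simp: \<A>_def)
  note Gc = subsetD[OF smE(1)[OF Gs]] and Nc = subsetD[OF smE(1)[OF assms(3)]]
  have "\<exists>g\<in>G. \<exists>n\<in>N. x = g \<oplus>\<^bsub>M\<^esub> n" if x: "x \<in> carrier M" for x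
  proof (rule ccontr)
    assume neg: "\<not> ?thesis"
    \<comment> \<open>The span of \<open>G\<close> and the vector \<open>x\<close> that escapes
      \<open>G + N\<close>. Once \<open>H\<close> is shown to meet \<open>N\<close> trivially,
      maximality forces \<open>H = G\<close>, so \<open>x\<close> lies in \<open>G\<close>, against
      its choice.\<close>
    define H where "H = {g \<oplus>\<^bsub>M\<^esub> a \<odot>\<^bsub>M\<^esub> x | g a. g \<in> G \<and> a \<in> carrier K}"
    have HI: "g \<oplus>\<^bsub>M\<^esub> a \<odot>\<^bsub>M\<^esub> x \<in> H" if "g \<in> G" "a \<in> carrier K" for g a
      using that by (auto simp: H_def)
    have Hs: "submodule H K M"
    proof (rule M.submoduleI)
      show "H \<subseteq> carrier M" using Gc x by (auto simp: H_def)
      show "\<zero>\<^bsub>M\<^esub> \<in> H" using HI[OF z[OF Gs], of "\<zero>\<^bsub>K\<^esub>"] x by simp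
      show "\<ominus>\<^bsub>M\<^esub> h \<in> H" if "h \<in> H" for h
      proof -
        obtain g a where ga: "h = g \<oplus>\<^bsub>M\<^esub> a \<odot>\<^bsub>M\<^esub> x" "g \<in> G" "a \<in> carrier K"
          using \<open>h \<in> H\<close> by (auto simp: H_def)
        then have "\<ominus>\<^bsub>M\<^esub> h = \<ominus>\<^bsub>M\<^esub> g \<oplus>\<^bsub>M\<^esub> (\<ominus>\<^bsub>K\<^esub> a) \<odot>\<^bsub>M\<^esub> x"
          using x Gc by (simp add: M.M.minus_add M.smult_l_minus)
        then show ?thesis using HI[OF smE(3)[OF Gs ga(2)], of "\<ominus>\<^bsub>K\<^esub> a"] ga(3) by simp
      qed
      show "h \<oplus>\<^bsub>M\<^esub> h' \<in> H" if "h \<in> H" "h' \<in> H" for h h'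
      proof -
        obtain g a g' a' where ga: "h = g \<oplus>\<^bsub>M\<^esub> a \<odot>\<^bsub>M\<^esub> x" "g \<in> G" "a \<in> carrier K"
          "h' = g' \<oplus>\<^bsub>M\<^esub> a' \<odot>\<^bsub>M\<^esub> x" "g' \<in> G" "a' \<in> carrier K"
          using \<open>h \<in> H\<close> \<open>h' \<in> H\<close> by (auto simp: H_def)
        then have "h \<oplus>\<^bsub>M\<^esub> h' = (g \<oplus>\<^bsub>M\<^esub> g') \<oplus>\<^bsub>M\<^esub> (a \<oplus>\<^bsub>K\<^esub> a') \<odot>\<^bsub>M\<^esub> x"
          using x Gc by (simp add: M.smult_l_distr M.M.add4)
        then show ?thesis using HI[OF smE(5)[OF Gs ga(2,5)], of "a \<oplus>\<^bsub>K\<^esub> a'"] ga(3,6) by simp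
      qed
      show "b \<odot>\<^bsub>M\<^esub> h \<in> H" if "b \<in> carrier K" "h \<in> H" for b h
      proof -
        obtain g a where ga: "h = g \<oplus>\<^bsub>M\<^esub> a \<odot>\<^bsub>M\<^esub> x" "g \<in> G" "a \<in> carrier K"
          using \<open>h \<in> H\<close> by (auto simp: H_def)
        then have "b \<odot>\<^bsub>M\<^esub> h = b \<odot>\<^bsub>M\<^esub> g \<oplus>\<^bsub>M\<^esub> (b \<otimes>\<^bsub>K\<^esub> a) \<odot>\<^bsub>M\<^esub> x"
          using x Gc that by (simp add: M.smult_r_distr M.smult_assoc1)
        then show ?thesis using HI[OF smE(4)[OF Gs that(1) ga(2)], of "b \<otimes>\<^bsub>K\<^esub> a"] ga(3) that by simp
      qed
    qed
    have "h = \<zero>\<^bsub>M\<^esub>" if h: "h \<in> H" "h \<in> N" for h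
    proof -
      obtain g a where ga: "h = g \<oplus>\<^bsub>M\<^esub> a \<odot>\<^bsub>M\<^esub> x" "g \<in> G" "a \<in> carrier K"
        using h by (auto simp: H_def)
      have gM: "g \<in> carrier M" and hM: "h \<in> carrier M" using Gc Nc ga h by auto
      have "a = \<zero>\<^bsub>K\<^esub>"
      proof (rule ccontr)
        assume "a \<noteq> \<zero>\<^bsub>K\<^esub>"
        then have b: "inv\<^bsub>K\<^esub> a \<in> carrier K" "inv\<^bsub>K\<^esub> a \<otimes>\<^bsub>K\<^esub> a = \<one>\<^bsub>K\<^esub>"
          using ga(3) K.field_Units by auto
        let ?b = "inv\<^bsub>K\<^esub> a"
        have "a \<odot>\<^bsub>M\<^esub> x = \<ominus>\<^bsub>M\<^esub> g \<oplus>\<^bsub>M\<^esub> h"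
          using ga x gM by (simp add: M.M.r_neg1)
        then have "x = ?b \<odot>\<^bsub>M\<^esub> (\<ominus>\<^bsub>M\<^esub> g \<oplus>\<^bsub>M\<^esub> h)"
          using b ga(3) x by (metis M.smult_assoc1 M.smult_one)
        also have "\<dots> = ?b \<odot>\<^bsub>M\<^esub> (\<ominus>\<^bsub>M\<^esub> g) \<oplus>\<^bsub>M\<^esub> ?b \<odot>\<^bsub>M\<^esub> h"
          using b gM hM by (simp add: M.smult_r_distr)
        finally show False
          using neg smE(4)[OF Gs b(1) smE(3)[OF Gs ga(2)]] smE(4)[OF assms(3) b(1) h(2)] by blast
      qed
      then have "h = g" using ga gM x by simp
      then show ?thesis using GN h ga by auto
    qed
    then have "H \<inter> N = {\<zero>\<^bsub>M\<^esub>}" using z[OF Hs] N0 by blast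
    then have "H \<in> \<A>" using Hs by (simp add: \<A>_def)
    moreover have "G \<subseteq> H"
    proof
      fix g assume "g \<in> G"
      then show "g \<in> H" using HI[of g "\<zero>\<^bsub>K\<^esub>"] x Gc[of g] by simp
    qed
    ultimately have "H = G" by (rule max)
    moreover have "x \<in> H" using HI[OF z[OF Gs], of "\<one>\<^bsub>K\<^esub>"] x by simp
    ultimately have "x \<in> G" by simp
    moreover have "x = x \<oplus>\<^bsub>M\<^esub> \<zero>\<^bsub>M\<^esub>" using x by simp
    ultimately show False using neg N0 by blast
  qed
  then show ?thesis using Gs GN by blast
qed

lemma exists_linear_section:
  assumes "field K" "module K M" "module K N" "p \<in> linear_maps K M N"
    and surj: "p ` carrier M = carrier N"
  shows "\<exists>\<sigma>\<in>linear_maps K N M. \<forall>x\<in>carrier N. p (\<sigma> x) = x"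
proof -
  interpret M: module K M by fact
  interpret N: module K N by fact
  note p = linear_maps_closed[OF assms(4)] linear_maps_add[OF assms(4)] linear_maps_smult[OF assms(4)]
    linear_maps_zero[OF M.M.abelian_group_axioms N.M.abelian_group_axioms assms(4)]
    linear_maps_minus[OF M.M.abelian_group_axioms N.M.abelian_group_axioms assms(4)]
  have "submodule {x \<in> carrier M. p x = \<zero>\<^bsub>N\<^esub>} K M"
    by (rule M.submoduleI) (auto simp: p)
  from exists_complement[OF assms(1,2) this]
  obtain G where G: "submodule G K M" and int: "G \<inter> {x \<in> carrier M. p x = \<zero>\<^bsub>N\<^esub>} = {\<zero>\<^bsub>M\<^esub>}"
    and dec: "\<forall>x\<in>carrier M. \<exists>g\<in>G. \<exists>n\<in>{x \<in> carrier M. p x = \<zero>\<^bsub>N\<^esub>}. x = g \<oplus>\<^bsub>M\<^esub> n"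
    by (elim exE conjE) (rule that)
  note GE = M.submoduleE[OF G]
  have inj: "inj_on p G"
  proof (rule inj_onI)
    fix a b assume ab: "a \<in> G" "b \<in> G" "p a = p b"
    then have c: "a \<in> carrier M" "b \<in> carrier M" using GE(1) by auto
    then have "p (a \<ominus>\<^bsub>M\<^esub> b) = \<zero>\<^bsub>N\<^esub>"
      using ab(3) p(1)[of b] by (simp add: a_minus_def p N.M.r_neg)
    moreover have "a \<ominus>\<^bsub>M\<^esub> b \<in> G" using ab GE(3,5) by (simp add: a_minus_def)
    ultimately have "a \<ominus>\<^bsub>M\<^esub> b = \<zero>\<^bsub>M\<^esub>" using int c by blast
    then show "a = b" using M.M.add_minus_cancel[of b a] c by simp
  qed
  \<comment> \<open>The complement as a module in its own right: on it \<open>p\<close> is injective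
    and still onto, so the inverse is a linear map into \<open>?M\<close>, whose codomain is
    afterwards enlarged to \<open>M\<close>.\<close>
  let ?M = "M\<lparr>carrier := G\<rparr>"
  have sub: "(\<lambda>x. x) ` carrier N \<subseteq> p ` carrier ?M"
  proof
    fix y assume "y \<in> (\<lambda>x. x) ` carrier N"
    then obtain x where x: "x \<in> carrier M" "y = p x" using surj by auto
    obtain g n where "g \<in> G" "n \<in> carrier M" "p n = \<zero>\<^bsub>N\<^esub>" "x = g \<oplus>\<^bsub>M\<^esub> n" using dec x(1) by blast
    moreover have "g \<in> carrier M" using \<open>g \<in> G\<close> GE(1) by blast
    ultimately have "p x = p g" by (simp add: p)
    then show "y \<in> p ` carrier ?M" using x \<open>g \<in> G\<close> by auto
  qed
  have "module K ?M" by (rule submodule.submodule_is_module[OF G assms(2)])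
  moreover have "p \<in> linear_maps K ?M N"
    by (rule linear_mapsI) (simp_all add: p subsetD[OF GE(1)])
  moreover have "(\<lambda>x. x) \<in> linear_maps K N N" by (rule linear_mapsI) auto
  ultimately have "inv_into G p \<in> linear_maps K N ?M"
    using linear_maps_inv_into[of K ?M p N "\<lambda>x. x" N] inj sub by simp
  then have "inv_into G p \<in> linear_maps K N M" using GE(1) by (simp add: linear_maps_def Pi_iff subset_iff)
  moreover have "\<forall>x\<in>carrier N. p (inv_into G p x) = x" using sub by (auto intro: f_inv_into_f)
  ultimately show ?thesis by blast
qed

text \<open>One set of rewrite rules for all the trilinear maps that occur: the brackets,
  \<open>\<theta>\<close>, \<open>D\<close> and the cocycles. The argument spaces are kept apart
  because \<open>\<theta>\<close> and \<open>D\<close> take two arguments in \<open>T\<close> and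
  one in \<open>V\<close>.\<close>

locale trilinear_map =
  A: abelian_group A + B: abelian_group B + C: abelian_group C + N: abelian_group N
  for K :: "('k, 'm) ring_scheme" and A :: "('k, 'a, 'p) module_scheme"
    and B :: "('k, 'b, 'q) module_scheme" and C :: "('k, 'c, 'r) module_scheme"
    and N :: "('k, 'd, 's) module_scheme" +
  fixes f :: "'a \<Rightarrow> 'b \<Rightarrow> 'c \<Rightarrow> 'd"
  assumes trilinear: "f \<in> trilinear_maps K A B C N"
begin

lemma linear1: "y \<in> carrier B \<Longrightarrow> z \<in> carrier C \<Longrightarrow> (\<lambda>x. f x y z) \<in> linear_maps K A N"
  and linear2: "x \<in> carrier A \<Longrightarrow> z \<in> carrier C \<Longrightarrow> (\<lambda>y. f x y z) \<in> linear_maps K B N"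
  and linear3: "x \<in> carrier A \<Longrightarrow> y \<in> carrier B \<Longrightarrow> (\<lambda>z. f x y z) \<in> linear_maps K C N"
  using trilinear by (auto simp: trilinear_maps_def)

lemma closed [simp]:
  "x \<in> carrier A \<Longrightarrow> y \<in> carrier B \<Longrightarrow> z \<in> carrier C \<Longrightarrow> f x y z \<in> carrier N"
  using linear_maps_closed[OF linear1] by auto

lemma add1: "\<lbrakk>x \<in> carrier A; x' \<in> carrier A; y \<in> carrier B; z \<in> carrier C\<rbrakk> \<Longrightarrow>
    f (x \<oplus>\<^bsub>A\<^esub> x') y z = f x y z \<oplus>\<^bsub>N\<^esub> f x' y z"
  and add2: "\<lbrakk>x \<in> carrier A; y \<in> carrier B; y' \<in> carrier B; z \<in> carrier C\<rbrakk> \<Longrightarrow>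
    f x (y \<oplus>\<^bsub>B\<^esub> y') z = f x y z \<oplus>\<^bsub>N\<^esub> f x y' z"
  and add3: "\<lbrakk>x \<in> carrier A; y \<in> carrier B; z \<in> carrier C; z' \<in> carrier C\<rbrakk> \<Longrightarrow>
    f x y (z \<oplus>\<^bsub>C\<^esub> z') = f x y z \<oplus>\<^bsub>N\<^esub> f x y z'"
  using linear_maps_add[OF linear1] linear_maps_add[OF linear2] linear_maps_add[OF linear3] by auto

lemma smult1: "\<lbrakk>a \<in> carrier K; x \<in> carrier A; y \<in> carrier B; z \<in> carrier C\<rbrakk> \<Longrightarrow>
    f (a \<odot>\<^bsub>A\<^esub> x) y z = a \<odot>\<^bsub>N\<^esub> f x y z"
  and smult2: "\<lbrakk>a \<in> carrier K; x \<in> carrier A; y \<in> carrier B; z \<in> carrier C\<rbrakk> \<Longrightarrow>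
    f x (a \<odot>\<^bsub>B\<^esub> y) z = a \<odot>\<^bsub>N\<^esub> f x y z"
  and smult3: "\<lbrakk>a \<in> carrier K; x \<in> carrier A; y \<in> carrier B; z \<in> carrier C\<rbrakk> \<Longrightarrow>
    f x y (a \<odot>\<^bsub>C\<^esub> z) = a \<odot>\<^bsub>N\<^esub> f x y z"
  using linear_maps_smult[OF linear1] linear_maps_smult[OF linear2] linear_maps_smult[OF linear3]
  by auto

lemma minus1: "\<lbrakk>x \<in> carrier A; y \<in> carrier B; z \<in> carrier C\<rbrakk> \<Longrightarrow>
    f (\<ominus>\<^bsub>A\<^esub> x) y z = \<ominus>\<^bsub>N\<^esub> f x y z"
  and minus2: "\<lbrakk>x \<in> carrier A; y \<in> carrier B; z \<in> carrier C\<rbrakk> \<Longrightarrow>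
    f x (\<ominus>\<^bsub>B\<^esub> y) z = \<ominus>\<^bsub>N\<^esub> f x y z"
  and minus3: "\<lbrakk>x \<in> carrier A; y \<in> carrier B; z \<in> carrier C\<rbrakk> \<Longrightarrow>
    f x y (\<ominus>\<^bsub>C\<^esub> z) = \<ominus>\<^bsub>N\<^esub> f x y z"
  using linear_maps_minus[OF A.abelian_group_axioms N.abelian_group_axioms linear1]
    linear_maps_minus[OF B.abelian_group_axioms N.abelian_group_axioms linear2]
    linear_maps_minus[OF C.abelian_group_axioms N.abelian_group_axioms linear3]
  by auto

lemma zero1 [simp]: "\<lbrakk>y \<in> carrier B; z \<in> carrier C\<rbrakk> \<Longrightarrow> f \<zero>\<^bsub>A\<^esub> y z = \<zero>\<^bsub>N\<^esub>"
  and zero2 [simp]: "\<lbrakk>x \<in> carrier A; z \<in> carrier C\<rbrakk> \<Longrightarrow> f x \<zero>\<^bsub>B\<^esub> z = \<zero>\<^bsub>N\<^esub>"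
  and zero3 [simp]: "\<lbrakk>x \<in> carrier A; y \<in> carrier B\<rbrakk> \<Longrightarrow> f x y \<zero>\<^bsub>C\<^esub> = \<zero>\<^bsub>N\<^esub>"
  using linear_maps_zero[OF A.abelian_group_axioms N.abelian_group_axioms linear1]
    linear_maps_zero[OF B.abelian_group_axioms N.abelian_group_axioms linear2]
    linear_maps_zero[OF C.abelian_group_axioms N.abelian_group_axioms linear3]
  by auto

lemmas add = add1 add2 add3
lemmas minus = minus1 minus2 minus3
lemmas smult = smult1 smult2 smult3

end

lemma trilinear_mapsI:
  assumes "\<And>y z. y \<in> carrier B \<Longrightarrow> z \<in> carrier C \<Longrightarrow> (\<lambda>x. f x y z) \<in> linear_maps K A N"
    and "\<And>x z. x \<in> carrier A \<Longrightarrow> z \<in> carrier C \<Longrightarrow> (\<lambda>y. f x y z) \<in> linear_maps K B N"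
    and "\<And>x y. x \<in> carrier A \<Longrightarrow> y \<in> carrier B \<Longrightarrow> (\<lambda>z. f x y z) \<in> linear_maps K C N"
  shows "f \<in> trilinear_maps K A B C N"
  using assms by (auto simp: trilinear_maps_def)


section \<open>Lie triple systems and their representations\<close>

sublocale lie_triple_system \<subseteq> bracket: trilinear_map K T T T T "tbracket T"
  by unfold_locales (rule tbracket_trilinear)

context lie_triple_system
begin

text \<open>Polarization: expand \<open>[x + y, x + y, z] = 0\<close>.\<close>

lemma bracket_skew:
  assumes "x \<in> carrier T" "y \<in> carrier T" "z \<in> carrier T"
  shows "tbracket T x y z = \<ominus>\<^bsub>T\<^esub> tbracket T y x z"
proof -
  have "\<zero>\<^bsub>T\<^esub> = tbracket T (x \<oplus>\<^bsub>T\<^esub> y) (x \<oplus>\<^bsub>T\<^esub> y) z"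
    using assms by (simp add: tbracket_alt)
  also have "\<dots> = tbracket T x (x \<oplus>\<^bsub>T\<^esub> y) z \<oplus>\<^bsub>T\<^esub> tbracket T y (x \<oplus>\<^bsub>T\<^esub> y) z"
    using assms by (intro bracket.add1) auto
  also have "\<dots> = tbracket T x y z \<oplus>\<^bsub>T\<^esub> tbracket T y x z"
    using assms by (simp add: bracket.add2 tbracket_alt)
  finally have "tbracket T x y z \<oplus>\<^bsub>T\<^esub> tbracket T y x z = \<zero>\<^bsub>T\<^esub>" by simp
  then show ?thesis using assms by (simp add: M.minus_equality)
qed

text \<open>The cyclic identity and skew-symmetry together move the last entry to the front. This
  reduces a bracket with an element of \<open>V\<close> in the last place to brackets with that
  element in the first place.\<close>

lemma bracket_last:
  assumes "x \<in> carrier T" "y \<in> carrier T" "z \<in> carrier T"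
  shows "tbracket T x y z = tbracket T z y x \<ominus>\<^bsub>T\<^esub> tbracket T z x y"
proof -
  have "tbracket T x y z \<oplus>\<^bsub>T\<^esub> (\<ominus>\<^bsub>T\<^esub> tbracket T z y x \<oplus>\<^bsub>T\<^esub> tbracket T z x y) = \<zero>\<^bsub>T\<^esub>"
    using tbracket_cyclic[of x y z] bracket_skew[of y z x] assms by (simp add: M.a_assoc)
  then have "tbracket T x y z = \<ominus>\<^bsub>T\<^esub> (\<ominus>\<^bsub>T\<^esub> tbracket T z y x \<oplus>\<^bsub>T\<^esub> tbracket T z x y)"
    using assms by (simp add: M.minus_equality)
  then show ?thesis using assms by (simp add: M.minus_add a_minus_def)
qed

end

sublocale lts_representation \<subseteq> rep: trilinear_map K T T V V \<theta>
  by unfold_locales (rule rep_trilinear)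

section \<open>Operator identities for \<open>D\<close> and the bracket of the semidirect
  product\<close>

context lts_representation
begin

abbreviation D :: "'t \<Rightarrow> 't \<Rightarrow> 'v \<Rightarrow> 'v" where "D \<equiv> rep_D V \<theta>"

lemma D_trilinear: "D \<in> trilinear_maps K T T V V"
proof (rule trilinear_mapsI)
  have m: "module K T" "module K V" by unfold_locales
  note diff = linear_maps_sum[OF m _ linear_maps_uminus[OF m]]
    linear_maps_sum[OF m(2,2) _ linear_maps_uminus[OF m(2,2)]]
  show "(\<lambda>x. D x y v) \<in> linear_maps K T V" if "y \<in> carrier T" "v \<in> carrier V" for y v
    unfolding rep_D_def a_minus_def by (rule diff(1)[OF rep.linear2[OF that] rep.linear1[OF that]])
  show "(\<lambda>y. D x y v) \<in> linear_maps K T V" if "x \<in> carrier T" "v \<in> carrier V" for x v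
    unfolding rep_D_def a_minus_def by (rule diff(1)[OF rep.linear1[OF that] rep.linear2[OF that]])
  show "D x y \<in> linear_maps K V V" if "x \<in> carrier T" "y \<in> carrier T" for x y
    unfolding rep_D_def a_minus_def by (rule diff(2)[OF rep.linear3[OF that(2,1)] rep.linear3[OF that]])
qed

end

sublocale lts_representation \<subseteq> D: trilinear_map K T T V V "rep_D V \<theta>"
  by unfold_locales (rule D_trilinear)

context lts_representation
begin

lemma D_alt: "x \<in> carrier T \<Longrightarrow> v \<in> carrier V \<Longrightarrow> D x x v = \<zero>\<^bsub>V\<^esub>"
  by (simp add: rep_D_def V.M.minus_self)

text \<open>(R1) solved for its first term, so that it can serve as a rewrite rule moving
  \<open>D x1 x2\<close> inwards.\<close>

lemma D_theta:
  assumes "x1 \<in> carrier T" "x2 \<in> carrier T" "y1 \<in> carrier T" "y2 \<in> carrier T" "v \<in> carrier V"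
  shows "D x1 x2 (\<theta> y1 y2 v) = \<theta> y1 y2 (D x1 x2 v) \<oplus>\<^bsub>V\<^esub>
    (\<theta> (tbracket T x1 x2 y1) y2 v \<oplus>\<^bsub>V\<^esub> \<theta> y1 (tbracket T x1 x2 y2) v)"
  using rep_R1[OF assms, symmetric] assms by (simp add: V.M.add_minus_cancel)

text \<open>\<open>D y1 y2\<close> is a difference of two values of \<open>\<theta>\<close>, so (R1)
  applies to each of them, and the four correction terms pair up again to two values of
  \<open>D\<close>.\<close>

lemma D_D:
  assumes "x1 \<in> carrier T" "x2 \<in> carrier T" "y1 \<in> carrier T" "y2 \<in> carrier T" "v \<in> carrier V"
  shows "D x1 x2 (D y1 y2 v) = D y1 y2 (D x1 x2 v) \<oplus>\<^bsub>V\<^esub>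
    (D (tbracket T x1 x2 y1) y2 v \<oplus>\<^bsub>V\<^esub> D y1 (tbracket T x1 x2 y2) v)"
proof -
  have "D x1 x2 (D y1 y2 v) = D x1 x2 (\<theta> y2 y1 v) \<ominus>\<^bsub>V\<^esub> D x1 x2 (\<theta> y1 y2 v)"
    using assms by (simp add: rep_D_def[of V \<theta> y1] a_minus_def D.add D.minus)
  also have "\<dots> = (\<theta> y2 y1 (D x1 x2 v) \<ominus>\<^bsub>V\<^esub> \<theta> y1 y2 (D x1 x2 v)) \<oplus>\<^bsub>V\<^esub>
    ((\<theta> y2 (tbracket T x1 x2 y1) v \<ominus>\<^bsub>V\<^esub> \<theta> (tbracket T x1 x2 y1) y2 v) \<oplus>\<^bsub>V\<^esub>
     (\<theta> (tbracket T x1 x2 y2) y1 v \<ominus>\<^bsub>V\<^esub> \<theta> y1 (tbracket T x1 x2 y2) v))"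
    using assms by (simp add: D_theta a_minus_def V.M.minus_add V.M.a_ac)
  finally show ?thesis by (simp add: rep_D_def)
qed

text \<open>The \<open>V\<close>-component of the bracket of \<open>(u1, x1)\<close>,
  \<open>(u2, x2)\<close>, \<open>(u3, x3)\<close> in the semidirect product of \<open>T\<close> and
  \<open>V\<close>. Each term has exactly one entry from \<open>V\<close>: the three terms are
  \<open>[u1, x2, x3]\<close>, \<open>[x1, u2, x3]\<close> and \<open>[x1, x2, u3]\<close>.\<close>

definition semidirect_bracket :: "'v \<Rightarrow> 't \<Rightarrow> 'v \<Rightarrow> 't \<Rightarrow> 'v \<Rightarrow> 't \<Rightarrow> 'v" where
  "semidirect_bracket u1 x1 u2 x2 u3 x3 = \<theta> x2 x3 u1 \<ominus>\<^bsub>V\<^esub> \<theta> x1 x3 u2 \<oplus>\<^bsub>V\<^esub> D x1 x2 u3"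

lemma semidirect_bracket_closed [simp]:
  "\<lbrakk>u1 \<in> carrier V; u2 \<in> carrier V; u3 \<in> carrier V; x1 \<in> carrier T; x2 \<in> carrier T; x3 \<in> carrier T\<rbrakk>
    \<Longrightarrow> semidirect_bracket u1 x1 u2 x2 u3 x3 \<in> carrier V"
  by (simp add: semidirect_bracket_def)

lemma semidirect_bracket_alt:
  "\<lbrakk>u1 \<in> carrier V; u2 \<in> carrier V; x1 \<in> carrier T; x2 \<in> carrier T\<rbrakk>
    \<Longrightarrow> semidirect_bracket u1 x1 u1 x1 u2 x2 = \<zero>\<^bsub>V\<^esub>"
  by (simp add: semidirect_bracket_def D_alt V.M.minus_self)

text \<open>Collecting the terms of each \<open>u\<close> separately leaves three sums of the form
  \<open>\<theta> x y u - \<theta> y x u + D x y u\<close>, which vanish by the definition of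
  \<open>D\<close>.\<close>

lemma semidirect_bracket_cyclic:
  assumes "u1 \<in> carrier V" "u2 \<in> carrier V" "u3 \<in> carrier V"
    "x1 \<in> carrier T" "x2 \<in> carrier T" "x3 \<in> carrier T"
  shows "semidirect_bracket u1 x1 u2 x2 u3 x3 \<oplus>\<^bsub>V\<^esub> semidirect_bracket u2 x2 u3 x3 u1 x1 \<oplus>\<^bsub>V\<^esub>
     semidirect_bracket u3 x3 u1 x1 u2 x2 = \<zero>\<^bsub>V\<^esub>"
proof -
  have cancel: "\<theta> x y u \<ominus>\<^bsub>V\<^esub> \<theta> y x u \<oplus>\<^bsub>V\<^esub> D x y u = \<zero>\<^bsub>V\<^esub>"
    if "x \<in> carrier T" "y \<in> carrier T" "u \<in> carrier V" for x y u
    using that by (simp add: rep_D_def a_minus_def V.M.a_ac V.M.r_neg V.M.r_neg1 V.M.r_neg2)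
  have "semidirect_bracket u1 x1 u2 x2 u3 x3 \<oplus>\<^bsub>V\<^esub> semidirect_bracket u2 x2 u3 x3 u1 x1 \<oplus>\<^bsub>V\<^esub>
     semidirect_bracket u3 x3 u1 x1 u2 x2 =
     (\<theta> x2 x3 u1 \<ominus>\<^bsub>V\<^esub> \<theta> x3 x2 u1 \<oplus>\<^bsub>V\<^esub> D x2 x3 u1) \<oplus>\<^bsub>V\<^esub>
     (\<theta> x3 x1 u2 \<ominus>\<^bsub>V\<^esub> \<theta> x1 x3 u2 \<oplus>\<^bsub>V\<^esub> D x3 x1 u2) \<oplus>\<^bsub>V\<^esub>
     (\<theta> x1 x2 u3 \<ominus>\<^bsub>V\<^esub> \<theta> x2 x1 u3 \<oplus>\<^bsub>V\<^esub> D x1 x2 u3)"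
    using assms by (simp add: semidirect_bracket_def a_minus_def V.M.a_ac)
  then show ?thesis using assms by (simp add: cancel)
qed

text \<open>Both sides are linear in the five vectors and can be compared vector by vector. The
  terms in \<open>u1\<close> and \<open>u2\<close> match by (R2), those in \<open>v1\<close> and
  \<open>v2\<close> by (R1), and those in \<open>v3\<close> by its consequence
  \<open>D_D\<close>.\<close>

lemma semidirect_bracket_derivation:
  assumes "u1 \<in> carrier V" "u2 \<in> carrier V" "v1 \<in> carrier V" "v2 \<in> carrier V" "v3 \<in> carrier V"
    "x1 \<in> carrier T" "x2 \<in> carrier T" "y1 \<in> carrier T" "y2 \<in> carrier T" "y3 \<in> carrier T"
  shows "semidirect_bracket u1 x1 u2 x2 (semidirect_bracket v1 y1 v2 y2 v3 y3) (tbracket T y1 y2 y3) =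
    semidirect_bracket (semidirect_bracket u1 x1 u2 x2 v1 y1) (tbracket T x1 x2 y1) v2 y2 v3 y3 \<oplus>\<^bsub>V\<^esub>
    semidirect_bracket v1 y1 (semidirect_bracket u1 x1 u2 x2 v2 y2) (tbracket T x1 x2 y2) v3 y3 \<oplus>\<^bsub>V\<^esub>
    semidirect_bracket v1 y1 v2 y2 (semidirect_bracket u1 x1 u2 x2 v3 y3) (tbracket T x1 x2 y3)"
  using assms
  by (simp add: semidirect_bracket_def a_minus_def rep.add rep.minus D.add D.minus V.M.minus_add
      D_theta[of x1 x2] D_D[of x1 x2 y1 y2] rep_R2[of x1 y1 y2 y3 u2] rep_R2[of x2 y1 y2 y3 u1] V.M.a_ac)

text \<open>All three vectors vary at once while the elements of \<open>T\<close> stay fixed;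
  additivity holds because no term contains two vectors. This is what makes the coboundary additive
  in \<open>\<nu>\<close>.\<close>

lemma semidirect_bracket_add:
  assumes "u1 \<in> carrier V" "u2 \<in> carrier V" "u3 \<in> carrier V"
    "v1 \<in> carrier V" "v2 \<in> carrier V" "v3 \<in> carrier V"
    "x1 \<in> carrier T" "x2 \<in> carrier T" "x3 \<in> carrier T"
  shows "semidirect_bracket (u1 \<oplus>\<^bsub>V\<^esub> v1) x1 (u2 \<oplus>\<^bsub>V\<^esub> v2) x2 (u3 \<oplus>\<^bsub>V\<^esub> v3) x3 =
    semidirect_bracket u1 x1 u2 x2 u3 x3 \<oplus>\<^bsub>V\<^esub> semidirect_bracket v1 x1 v2 x2 v3 x3"
  using assms
  by (simp add: semidirect_bracket_def a_minus_def rep.add D.add V.M.minus_add V.M.a_ac)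

lemma semidirect_bracket_smult:
  assumes "u1 \<in> carrier V" "u2 \<in> carrier V" "u3 \<in> carrier V" "a \<in> carrier K"
    "x1 \<in> carrier T" "x2 \<in> carrier T" "x3 \<in> carrier T"
  shows "semidirect_bracket (a \<odot>\<^bsub>V\<^esub> u1) (a \<odot>\<^bsub>T\<^esub> x1) u2 x2 u3 x3 = a \<odot>\<^bsub>V\<^esub> semidirect_bracket u1 x1 u2 x2 u3 x3"
    "semidirect_bracket u1 x1 (a \<odot>\<^bsub>V\<^esub> u2) (a \<odot>\<^bsub>T\<^esub> x2) u3 x3 = a \<odot>\<^bsub>V\<^esub> semidirect_bracket u1 x1 u2 x2 u3 x3"
    "semidirect_bracket u1 x1 u2 x2 (a \<odot>\<^bsub>V\<^esub> u3) (a \<odot>\<^bsub>T\<^esub> x3) = a \<odot>\<^bsub>V\<^esub> semidirect_bracket u1 x1 u2 x2 u3 x3"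
  using assms
  by (simp_all add: semidirect_bracket_def a_minus_def rep.smult D.smult V.smult_r_distr V.smult_r_minus)

text \<open>Here one whole pair varies, as trilinearity of the bracket on pairs requires.\<close>

lemma semidirect_bracket_add_slot:
  assumes "u1 \<in> carrier V" "u2 \<in> carrier V" "u3 \<in> carrier V" "v \<in> carrier V"
    "x1 \<in> carrier T" "x2 \<in> carrier T" "x3 \<in> carrier T" "y \<in> carrier T"
  shows "semidirect_bracket (u1 \<oplus>\<^bsub>V\<^esub> v) (x1 \<oplus>\<^bsub>T\<^esub> y) u2 x2 u3 x3 =
      semidirect_bracket u1 x1 u2 x2 u3 x3 \<oplus>\<^bsub>V\<^esub> semidirect_bracket v y u2 x2 u3 x3"
    "semidirect_bracket u1 x1 (u2 \<oplus>\<^bsub>V\<^esub> v) (x2 \<oplus>\<^bsub>T\<^esub> y) u3 x3 =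
      semidirect_bracket u1 x1 u2 x2 u3 x3 \<oplus>\<^bsub>V\<^esub> semidirect_bracket u1 x1 v y u3 x3"
    "semidirect_bracket u1 x1 u2 x2 (u3 \<oplus>\<^bsub>V\<^esub> v) (x3 \<oplus>\<^bsub>T\<^esub> y) =
      semidirect_bracket u1 x1 u2 x2 u3 x3 \<oplus>\<^bsub>V\<^esub> semidirect_bracket u1 x1 u2 x2 v y"
  using assms
  by (simp_all add: semidirect_bracket_def a_minus_def rep.add D.add V.M.minus_add V.M.a_ac)

text \<open>Isolates the effect of perturbing one vector by \<open>w\<close>. In nested brackets
  \<open>w\<close> is a value of the cocycle, and the extra terms are the \<open>\<theta>\<close>
  and \<open>D\<close> terms of the cocycle identity.\<close>

lemma semidirect_bracket_slot:
  assumes "w \<in> carrier V" "x1 \<in> carrier T" "x2 \<in> carrier T" "x3 \<in> carrier T"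
    "u1 \<in> carrier V" "u2 \<in> carrier V" "u3 \<in> carrier V"
  shows "semidirect_bracket (u1 \<oplus>\<^bsub>V\<^esub> w) x1 u2 x2 u3 x3 =
      semidirect_bracket u1 x1 u2 x2 u3 x3 \<oplus>\<^bsub>V\<^esub> \<theta> x2 x3 w"
    "semidirect_bracket u1 x1 (u2 \<oplus>\<^bsub>V\<^esub> w) x2 u3 x3 =
      semidirect_bracket u1 x1 u2 x2 u3 x3 \<oplus>\<^bsub>V\<^esub> \<ominus>\<^bsub>V\<^esub> \<theta> x1 x3 w"
    "semidirect_bracket u1 x1 u2 x2 (u3 \<oplus>\<^bsub>V\<^esub> w) x3 =
      semidirect_bracket u1 x1 u2 x2 u3 x3 \<oplus>\<^bsub>V\<^esub> D x1 x2 w"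
  using assms
  by (simp_all add: semidirect_bracket_def a_minus_def rep.add D.add V.M.minus_add V.M.a_ac)

lemma semidirect_bracket_zero:
  "\<lbrakk>x1 \<in> carrier T; x2 \<in> carrier T; u \<in> carrier V; x3 \<in> carrier T\<rbrakk> \<Longrightarrow>
   semidirect_bracket u x1 \<zero>\<^bsub>V\<^esub> x2 \<zero>\<^bsub>V\<^esub> x3 = \<theta> x2 x3 u"
  "\<lbrakk>x1 \<in> carrier T; x2 \<in> carrier T; u \<in> carrier V; x3 \<in> carrier T\<rbrakk> \<Longrightarrow>
   semidirect_bracket \<zero>\<^bsub>V\<^esub> x1 u x2 \<zero>\<^bsub>V\<^esub> x3 = \<ominus>\<^bsub>V\<^esub> \<theta> x1 x3 u"
  "\<lbrakk>x1 \<in> carrier T; x2 \<in> carrier T; u \<in> carrier V; x3 \<in> carrier T\<rbrakk> \<Longrightarrow>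
   semidirect_bracket \<zero>\<^bsub>V\<^esub> x1 \<zero>\<^bsub>V\<^esub> x2 u x3 = D x1 x2 u"
  by (simp_all add: semidirect_bracket_def a_minus_def)

text \<open>This form shows what \<open>d\<nu>\<close> measures: the failure of
  \<open>x \<mapsto> (\<nu> x, x)\<close> to be a homomorphism from \<open>T\<close> into the
  semidirect product.\<close>

lemma coboundary_eq:
  assumes "\<nu> \<in> linear_maps K T V" "x1 \<in> carrier T" "x2 \<in> carrier T" "x3 \<in> carrier T"
  shows "coboundary T V \<theta> \<nu> x1 x2 x3 =
    semidirect_bracket (\<nu> x1) x1 (\<nu> x2) x2 (\<nu> x3) x3 \<ominus>\<^bsub>V\<^esub> \<nu> (tbracket T x1 x2 x3)"
  using assms linear_maps_closed[OF assms(1)]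
  by (simp add: coboundary_def semidirect_bracket_def a_minus_def V.M.a_ac)

end

section \<open>Sections of abelian extensions\<close>

lemma carrier_zero_bracket_lts [simp]: "carrier (zero_bracket_lts V) = carrier V"
  by (simp add: zero_bracket_lts_def)

lemma linear_maps_zero_bracket_lts [simp]:
  "linear_maps K (zero_bracket_lts V) N = linear_maps K V N"
  by (simp add: linear_maps_def zero_bracket_lts_def)

locale lts_abelian_extension = lts_representation K T V \<theta>
  for K (structure) and T :: "('k, 't, 'n) lts_scheme" (structure)
    and V :: "('k, 'v, 'l) module_scheme" and \<theta> +
  fixes E :: "('k, 'e) lts" and i :: "'v \<Rightarrow> 'e" and p :: "'e \<Rightarrow> 't"
  assumes abelian_extension: "(E, i, p) \<in> abelian_extensions K T V \<theta>"

sublocale lts_abelian_extension \<subseteq> E: lie_triple_system K E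
  using abelian_extension by (simp add: abelian_extensions_def lts_extension_def)

context lts_abelian_extension
begin

lemma i_linear: "i \<in> linear_maps K V E"
  and p_linear: "p \<in> linear_maps K E T"
  and i_inj: "inj_on i (carrier V)"
  and i_image: "i ` carrier V = {x \<in> carrier E. p x = \<zero>\<^bsub>T\<^esub>}"
  and p_image: "p ` carrier E = carrier T"
  using abelian_extension by (auto simp: abelian_extensions_def lts_extension_def lts_hom_def)

lemma p_bracket: "\<lbrakk>a \<in> carrier E; b \<in> carrier E; c \<in> carrier E\<rbrakk> \<Longrightarrow>
    p (tbracket E a b c) = tbracket T (p a) (p b) (p c)"
  using abelian_extension by (auto simp: abelian_extensions_def lts_extension_def lts_hom_def)

lemma bracket_i1: "\<lbrakk>v \<in> carrier V; a \<in> carrier E; b \<in> carrier E\<rbrakk> \<Longrightarrow>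
    tbracket E (i v) a b = i (\<theta> (p a) (p b) v)"
  using abelian_extension by (auto simp: abelian_extensions_def)

lemmas i_closed [simp] = linear_maps_closed[OF i_linear]
lemmas p_closed [simp] = linear_maps_closed[OF p_linear]
lemmas i_add = linear_maps_add[OF i_linear]
lemmas p_add = linear_maps_add[OF p_linear]
lemmas i_smult = linear_maps_smult[OF i_linear]
lemmas p_smult = linear_maps_smult[OF p_linear]
lemmas i_zero [simp] = linear_maps_zero[OF V.M.abelian_group_axioms E.M.abelian_group_axioms i_linear]
lemmas i_minus = linear_maps_minus[OF V.M.abelian_group_axioms E.M.abelian_group_axioms i_linear]
lemmas i_diff = linear_maps_diff[OF V.M.abelian_group_axioms E.M.abelian_group_axioms i_linear]
lemmas p_zero [simp] = linear_maps_zero[OF E.M.abelian_group_axioms M.abelian_group_axioms p_linear]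
lemmas p_diff = linear_maps_diff[OF E.M.abelian_group_axioms M.abelian_group_axioms p_linear]

lemma p_i [simp]: "v \<in> carrier V \<Longrightarrow> p (i v) = \<zero>\<^bsub>T\<^esub>"
  using i_image by blast

lemma i_eq_iff [simp]: "u \<in> carrier V \<Longrightarrow> v \<in> carrier V \<Longrightarrow> i u = i v \<longleftrightarrow> u = v"
  using i_inj by (rule inj_on_eq_iff)

lemma bracket_i2: "\<lbrakk>v \<in> carrier V; a \<in> carrier E; b \<in> carrier E\<rbrakk> \<Longrightarrow>
    tbracket E a (i v) b = \<ominus>\<^bsub>E\<^esub> i (\<theta> (p a) (p b) v)"
  using E.bracket_skew[of a "i v" b] by (simp add: bracket_i1)

text \<open>Moving \<open>i v\<close> to the front yields
  \<open>\<theta> (p b) (p a) v - \<theta> (p a) (p b) v\<close>, which is the definition of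
  \<open>D\<close>.\<close>

lemma bracket_i3: "\<lbrakk>v \<in> carrier V; a \<in> carrier E; b \<in> carrier E\<rbrakk> \<Longrightarrow>
    tbracket E a b (i v) = i (D (p a) (p b) v)"
  using E.bracket_last[of a b "i v"] by (simp add: bracket_i1 rep_D_def i_diff)

text \<open>By exactness a linear map into \<open>E\<close> that is killed by \<open>p\<close>
  factors through \<open>i\<close>, and the factor is again linear.\<close>

lemma ker_retract:
  assumes "f \<in> linear_maps K L E" and "\<And>x. x \<in> carrier L \<Longrightarrow> p (f x) = \<zero>\<^bsub>T\<^esub>"
  shows "(\<lambda>x. inv_into (carrier V) i (f x)) \<in> linear_maps K L V"
    and "x \<in> carrier L \<Longrightarrow> i (inv_into (carrier V) i (f x)) = f x"
proof -
  have sub: "f ` carrier L \<subseteq> i ` carrier V"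
    using assms linear_maps_closed[OF assms(1)] i_image by auto
  show "(\<lambda>x. inv_into (carrier V) i (f x)) \<in> linear_maps K L V"
    using linear_maps_inv_into[OF V.module_axioms i_linear i_inj assms(1) sub] .
  show "x \<in> carrier L \<Longrightarrow> i (inv_into (carrier V) i (f x)) = f x"
    by (rule f_inv_into_f[OF subsetD[OF sub imageI]])
qed

end

section \<open>Coordinates on an extension given by a section\<close>

locale lts_extension_section = lts_abelian_extension K T V \<theta> E i p
  for K (structure) and T :: "('k, 't, 'n) lts_scheme" (structure)
    and V :: "('k, 'v, 'l) module_scheme" and \<theta> and E :: "('k, 'e) lts" and i p +
  fixes \<sigma>
  assumes linear_section: "\<sigma> \<in> linear_sections K T E p"
begin

lemma s_linear: "\<sigma> \<in> linear_maps K T E"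
  and p_s [simp]: "x \<in> carrier T \<Longrightarrow> p (\<sigma> x) = x"
  using linear_section by (auto simp: linear_sections_def)

lemmas s_closed [simp] = linear_maps_closed[OF s_linear]
lemmas s_add = linear_maps_add[OF s_linear]
lemmas s_smult = linear_maps_smult[OF s_linear]
lemmas s_zero [simp] = linear_maps_zero[OF M.abelian_group_axioms E.M.abelian_group_axioms s_linear]

abbreviation \<omega> :: "'t \<Rightarrow> 't \<Rightarrow> 't \<Rightarrow> 'v" where
  "\<omega> \<equiv> extension_cocycle T V E i \<sigma>"

definition emb :: "'v \<Rightarrow> 't \<Rightarrow> 'e" where
  "emb u x = i u \<oplus>\<^bsub>E\<^esub> \<sigma> x"

definition vpart :: "'e \<Rightarrow> 'v" where
  "vpart a = inv_into (carrier V) i (a \<ominus>\<^bsub>E\<^esub> \<sigma> (p a))"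

text \<open>The element \<open>a - \<sigma> (p a)\<close> is killed by \<open>p\<close>, hence comes
  from \<open>V\<close>, and it depends linearly on \<open>a\<close>.\<close>

lemma vpart_linear: "vpart \<in> linear_maps K E V"
  and i_vpart: "a \<in> carrier E \<Longrightarrow> i (vpart a) = a \<ominus>\<^bsub>E\<^esub> \<sigma> (p a)"
proof -
  have "(\<lambda>a. a \<oplus>\<^bsub>E\<^esub> \<ominus>\<^bsub>E\<^esub> \<sigma> (p a)) \<in> linear_maps K E E"
    by (intro linear_maps_sum[OF E.module_axioms E.module_axioms]
        linear_maps_uminus[OF E.module_axioms E.module_axioms]
        linear_maps_compose[OF p_linear s_linear]) (rule linear_mapsI, auto)
  then have lin: "(\<lambda>a. a \<ominus>\<^bsub>E\<^esub> \<sigma> (p a)) \<in> linear_maps K E E" by (simp add: a_minus_def)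
  have ker: "p (a \<ominus>\<^bsub>E\<^esub> \<sigma> (p a)) = \<zero>\<^bsub>T\<^esub>" if "a \<in> carrier E" for a
    using that by (simp add: p_diff M.minus_self)
  show "vpart \<in> linear_maps K E V"
    using ker_retract(1)[OF lin ker] unfolding vpart_def[abs_def] .
  show "a \<in> carrier E \<Longrightarrow> i (vpart a) = a \<ominus>\<^bsub>E\<^esub> \<sigma> (p a)"
    using ker_retract(2)[OF lin ker] by (simp add: vpart_def)
qed

lemmas vpart_closed [simp] = linear_maps_closed[OF vpart_linear]

lemma emb_closed [simp]: "u \<in> carrier V \<Longrightarrow> x \<in> carrier T \<Longrightarrow> emb u x \<in> carrier E"
  by (simp add: emb_def)

lemma p_emb [simp]: "u \<in> carrier V \<Longrightarrow> x \<in> carrier T \<Longrightarrow> p (emb u x) = x"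
  by (simp add: emb_def p_add)

lemma emb_zero [simp]: "x \<in> carrier T \<Longrightarrow> emb \<zero>\<^bsub>V\<^esub> x = \<sigma> x"
  by (simp add: emb_def)

lemma emb_vpart: "a \<in> carrier E \<Longrightarrow> emb (vpart a) (p a) = a"
  using E.M.add_minus_cancel[of "\<sigma> (p a)" a] by (simp add: emb_def i_vpart E.M.a_comm)

lemma emb_eq_iff [simp]:
  assumes "u \<in> carrier V" "v \<in> carrier V" "x \<in> carrier T" "y \<in> carrier T"
  shows "emb u x = emb v y \<longleftrightarrow> u = v \<and> x = y"
proof
  assume eq: "emb u x = emb v y"
  then have "x = y" using assms by (metis p_emb)
  then show "u = v \<and> x = y" using eq assms by (simp add: emb_def)
qed auto

lemma vpart_emb [simp]: "u \<in> carrier V \<Longrightarrow> x \<in> carrier T \<Longrightarrow> vpart (emb u x) = u"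
  using emb_vpart[of "emb u x"] by simp

lemma emb_add:
  "\<lbrakk>u \<in> carrier V; v \<in> carrier V; x \<in> carrier T; y \<in> carrier T\<rbrakk> \<Longrightarrow>
    emb u x \<oplus>\<^bsub>E\<^esub> emb v y = emb (u \<oplus>\<^bsub>V\<^esub> v) (x \<oplus>\<^bsub>T\<^esub> y)"
  by (simp add: emb_def i_add s_add E.M.add4)

lemma emb_smult:
  "\<lbrakk>a \<in> carrier K; u \<in> carrier V; x \<in> carrier T\<rbrakk> \<Longrightarrow>
    a \<odot>\<^bsub>E\<^esub> emb u x = emb (a \<odot>\<^bsub>V\<^esub> u) (a \<odot>\<^bsub>T\<^esub> x)"
  by (simp add: emb_def i_smult s_smult E.smult_r_distr)

text \<open>Since \<open>p\<close> sends the bracket of the three lifts to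
  \<open>[x1, x2, x3]\<close>, the term subtracted in the definition of the cocycle is the
  \<open>\<sigma> (p a)\<close> in \<open>vpart a\<close>.\<close>

lemma omega_eq_vpart:
  assumes "x1 \<in> carrier T" "x2 \<in> carrier T" "x3 \<in> carrier T"
  shows "\<omega> x1 x2 x3 = vpart (tbracket E (\<sigma> x1) (\<sigma> x2) (\<sigma> x3))"
  using assms by (simp add: extension_cocycle_def vpart_def p_bracket)

lemma omega_closed [simp]: "\<omega> x1 x2 x3 \<in> carrier V"
proof (cases "x1 \<in> carrier T \<and> x2 \<in> carrier T \<and> x3 \<in> carrier T")
  case True
  then show ?thesis by (simp add: omega_eq_vpart)
qed (auto simp: extension_cocycle_def)

lemma bracket_s:
  assumes "x1 \<in> carrier T" "x2 \<in> carrier T" "x3 \<in> carrier T"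
  shows "tbracket E (\<sigma> x1) (\<sigma> x2) (\<sigma> x3) = emb (\<omega> x1 x2 x3) (tbracket T x1 x2 x3)"
  using emb_vpart[of "tbracket E (\<sigma> x1) (\<sigma> x2) (\<sigma> x3)"] assms
  by (simp add: omega_eq_vpart p_bracket)

text \<open>The way values of \<open>\<omega>\<close> are computed below: exhibit the bracket of the
  lifts in coordinates and read off the first one, which is unique.\<close>

lemma omega_eqI:
  assumes "x1 \<in> carrier T" "x2 \<in> carrier T" "x3 \<in> carrier T" "v \<in> carrier V" "y \<in> carrier T"
    and "tbracket E (\<sigma> x1) (\<sigma> x2) (\<sigma> x3) = emb v y"
  shows "\<omega> x1 x2 x3 = v"
  using assms by (simp add: bracket_s)

text \<open>Of the eight terms of the expansion, those with at least two entries from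
  \<open>i V\<close> vanish, because an argument of \<open>\<theta>\<close> becomes
  \<open>p (i u) = \<zero>\<close>. The three terms with one such entry form the semidirect bracket,
  and the last one is the bracket of the lifts.\<close>

lemma bracket_emb:
  assumes "u1 \<in> carrier V" "u2 \<in> carrier V" "u3 \<in> carrier V"
    and "x1 \<in> carrier T" "x2 \<in> carrier T" "x3 \<in> carrier T"
  shows "tbracket E (emb u1 x1) (emb u2 x2) (emb u3 x3) =
    emb (semidirect_bracket u1 x1 u2 x2 u3 x3 \<oplus>\<^bsub>V\<^esub> \<omega> x1 x2 x3) (tbracket T x1 x2 x3)"
proof -
  have "tbracket E (emb u1 x1) (emb u2 x2) (emb u3 x3) =
     i (\<theta> x2 x3 u1) \<oplus>\<^bsub>E\<^esub> (\<ominus>\<^bsub>E\<^esub> i (\<theta> x1 x3 u2)) \<oplus>\<^bsub>E\<^esub> i (D x1 x2 u3) \<oplus>\<^bsub>E\<^esub>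
     tbracket E (\<sigma> x1) (\<sigma> x2) (\<sigma> x3)"
    using assms
    by (simp add: emb_def E.bracket.add bracket_i1 bracket_i2 bracket_i3 p_add E.M.a_ac)
  also have "\<dots> = i (semidirect_bracket u1 x1 u2 x2 u3 x3) \<oplus>\<^bsub>E\<^esub>
      emb (\<omega> x1 x2 x3) (tbracket T x1 x2 x3)"
    using assms by (simp add: bracket_s semidirect_bracket_def i_add i_diff a_minus_def i_minus)
  also have "\<dots> = emb (semidirect_bracket u1 x1 u2 x2 u3 x3 \<oplus>\<^bsub>V\<^esub> \<omega> x1 x2 x3) (tbracket T x1 x2 x3)"
    using assms by (simp add: emb_def i_add E.M.a_assoc)
  finally show ?thesis .
qed

lemma omega_trilinear: "\<omega> \<in> trilinear_maps K T T T V"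
proof (intro trilinear_mapsI linear_mapsI)
  fix x x' y z assume [simp]: "x \<in> carrier T" "x' \<in> carrier T" "y \<in> carrier T" "z \<in> carrier T"
  show "\<omega> (x \<oplus>\<^bsub>T\<^esub> x') y z = \<omega> x y z \<oplus>\<^bsub>V\<^esub> \<omega> x' y z"
    by (rule omega_eqI[where y = "tbracket T (x \<oplus>\<^bsub>T\<^esub> x') y z"])
      (simp_all add: s_add E.bracket.add bracket.add bracket_s emb_add)
  show "\<omega> y (x \<oplus>\<^bsub>T\<^esub> x') z = \<omega> y x z \<oplus>\<^bsub>V\<^esub> \<omega> y x' z"
    by (rule omega_eqI[where y = "tbracket T y (x \<oplus>\<^bsub>T\<^esub> x') z"])
      (simp_all add: s_add E.bracket.add bracket.add bracket_s emb_add)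
  show "\<omega> y z (x \<oplus>\<^bsub>T\<^esub> x') = \<omega> y z x \<oplus>\<^bsub>V\<^esub> \<omega> y z x'"
    by (rule omega_eqI[where y = "tbracket T y z (x \<oplus>\<^bsub>T\<^esub> x')"])
      (simp_all add: s_add E.bracket.add bracket.add bracket_s emb_add)
next
  fix a x y z assume [simp]: "a \<in> carrier K" "x \<in> carrier T" "y \<in> carrier T" "z \<in> carrier T"
  show "\<omega> (a \<odot>\<^bsub>T\<^esub> x) y z = a \<odot>\<^bsub>V\<^esub> \<omega> x y z"
    by (rule omega_eqI[where y = "tbracket T (a \<odot>\<^bsub>T\<^esub> x) y z"])
      (simp_all add: s_smult E.bracket.smult bracket.smult bracket_s emb_smult)
  show "\<omega> y (a \<odot>\<^bsub>T\<^esub> x) z = a \<odot>\<^bsub>V\<^esub> \<omega> y x z"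
    by (rule omega_eqI[where y = "tbracket T y (a \<odot>\<^bsub>T\<^esub> x) z"])
      (simp_all add: s_smult E.bracket.smult bracket.smult bracket_s emb_smult)
  show "\<omega> y z (a \<odot>\<^bsub>T\<^esub> x) = a \<odot>\<^bsub>V\<^esub> \<omega> y z x"
    by (rule omega_eqI[where y = "tbracket T y z (a \<odot>\<^bsub>T\<^esub> x)"])
      (simp_all add: s_smult E.bracket.smult bracket.smult bracket_s emb_smult)
qed simp_all

text \<open>The cases occurring in the derivation identity for lifts: there the inner bracket of
  lifts is some \<open>emb u x\<close>, and the other two entries of the outer bracket are
  lifts.\<close>

lemma bracket_s_emb:
  assumes "x1 \<in> carrier T" "x2 \<in> carrier T" "x3 \<in> carrier T" "u \<in> carrier V"
  shows "tbracket E (emb u x1) (\<sigma> x2) (\<sigma> x3) = emb (\<theta> x2 x3 u \<oplus>\<^bsub>V\<^esub> \<omega> x1 x2 x3) (tbracket T x1 x2 x3)"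
    "tbracket E (\<sigma> x1) (emb u x2) (\<sigma> x3) = emb (\<ominus>\<^bsub>V\<^esub> \<theta> x1 x3 u \<oplus>\<^bsub>V\<^esub> \<omega> x1 x2 x3) (tbracket T x1 x2 x3)"
    "tbracket E (\<sigma> x1) (\<sigma> x2) (emb u x3) = emb (D x1 x2 u \<oplus>\<^bsub>V\<^esub> \<omega> x1 x2 x3) (tbracket T x1 x2 x3)"
  using bracket_emb[of u "\<zero>\<^bsub>V\<^esub>" "\<zero>\<^bsub>V\<^esub>" x1 x2 x3] bracket_emb[of "\<zero>\<^bsub>V\<^esub>" u "\<zero>\<^bsub>V\<^esub>" x1 x2 x3]
    bracket_emb[of "\<zero>\<^bsub>V\<^esub>" "\<zero>\<^bsub>V\<^esub>" u x1 x2 x3] assms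
  by (simp_all add: semidirect_bracket_zero)

lemma omega_cocycle: "\<omega> \<in> cocycles3 K T V \<theta>"
proof -
  have alt: "\<omega> x1 x1 x2 = \<zero>\<^bsub>V\<^esub>" if "x1 \<in> carrier T" "x2 \<in> carrier T" for x1 x2
    using that by (intro omega_eqI[where y = "\<zero>\<^bsub>T\<^esub>"]) (simp_all add: E.tbracket_alt)
  have cyclic: "\<omega> x1 x2 x3 \<oplus>\<^bsub>V\<^esub> \<omega> x2 x3 x1 \<oplus>\<^bsub>V\<^esub> \<omega> x3 x1 x2 = \<zero>\<^bsub>V\<^esub>"
    if [simp]: "x1 \<in> carrier T" "x2 \<in> carrier T" "x3 \<in> carrier T" for x1 x2 x3
  proof -
    have "emb (\<omega> x1 x2 x3 \<oplus>\<^bsub>V\<^esub> \<omega> x2 x3 x1 \<oplus>\<^bsub>V\<^esub> \<omega> x3 x1 x2)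
      (tbracket T x1 x2 x3 \<oplus>\<^bsub>T\<^esub> tbracket T x2 x3 x1 \<oplus>\<^bsub>T\<^esub> tbracket T x3 x1 x2) = emb \<zero>\<^bsub>V\<^esub> \<zero>\<^bsub>T\<^esub>"
      using E.tbracket_cyclic[of "\<sigma> x1" "\<sigma> x2" "\<sigma> x3"] by (simp add: bracket_s emb_add)
    then show ?thesis by (subst (asm) emb_eq_iff) simp_all
  qed
  have derivation: "\<omega> x1 x2 (tbracket T y1 y2 y3) \<oplus>\<^bsub>V\<^esub> D x1 x2 (\<omega> y1 y2 y3) =
             \<omega> (tbracket T x1 x2 y1) y2 y3 \<oplus>\<^bsub>V\<^esub>
             \<omega> y1 (tbracket T x1 x2 y2) y3 \<oplus>\<^bsub>V\<^esub>
             \<omega> y1 y2 (tbracket T x1 x2 y3) \<oplus>\<^bsub>V\<^esub>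
             \<theta> y2 y3 (\<omega> x1 x2 y1) \<ominus>\<^bsub>V\<^esub>
             \<theta> y1 y3 (\<omega> x1 x2 y2) \<oplus>\<^bsub>V\<^esub>
             D y1 y2 (\<omega> x1 x2 y3)"
    if [simp]: "x1 \<in> carrier T" "x2 \<in> carrier T" "y1 \<in> carrier T" "y2 \<in> carrier T" "y3 \<in> carrier T"
    for x1 x2 y1 y2 y3
  proof -
    \<comment> \<open>The derivation identity of \<open>E\<close> at five lifts, in coordinates. The
      inner values of \<open>\<omega>\<close> pass through the outer brackets and become the
      \<open>\<theta>\<close> and \<open>D\<close> terms; the outer brackets add their own values of
      \<open>\<omega>\<close>.\<close>
    have "emb (D x1 x2 (\<omega> y1 y2 y3) \<oplus>\<^bsub>V\<^esub> \<omega> x1 x2 (tbracket T y1 y2 y3))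
        (tbracket T x1 x2 (tbracket T y1 y2 y3)) =
      emb (\<theta> y2 y3 (\<omega> x1 x2 y1) \<oplus>\<^bsub>V\<^esub> \<omega> (tbracket T x1 x2 y1) y2 y3 \<oplus>\<^bsub>V\<^esub>
         (\<ominus>\<^bsub>V\<^esub> \<theta> y1 y3 (\<omega> x1 x2 y2) \<oplus>\<^bsub>V\<^esub> \<omega> y1 (tbracket T x1 x2 y2) y3) \<oplus>\<^bsub>V\<^esub>
         (D y1 y2 (\<omega> x1 x2 y3) \<oplus>\<^bsub>V\<^esub> \<omega> y1 y2 (tbracket T x1 x2 y3)))
        (tbracket T (tbracket T x1 x2 y1) y2 y3 \<oplus>\<^bsub>T\<^esub> tbracket T y1 (tbracket T x1 x2 y2) y3 \<oplus>\<^bsub>T\<^esub>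
         tbracket T y1 y2 (tbracket T x1 x2 y3))"
      using E.tbracket_derivation[of "\<sigma> x1" "\<sigma> x2" "\<sigma> y1" "\<sigma> y2" "\<sigma> y3"]
      by (simp add: bracket_s bracket_s_emb emb_add)
    then show ?thesis
      by (subst (asm) emb_eq_iff) (simp_all add: a_minus_def V.M.a_ac)
  qed
  have ext: "\<omega> x1 x2 x3 = \<zero>\<^bsub>V\<^esub>" if "\<not> (x1 \<in> carrier T \<and> x2 \<in> carrier T \<and> x3 \<in> carrier T)" for x1 x2 x3
    using that by (auto simp: extension_cocycle_def)
  show ?thesis
    unfolding cocycles3_def
    by (intro CollectI conjI ballI allI impI omega_trilinear alt cyclic derivation ext)
qed

lemma shifted_section:
  assumes \<nu>: "\<nu> \<in> linear_maps K T V"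
  shows "(\<lambda>x. emb (\<nu> x) x) \<in> linear_sections K T E p"
    and "extension_cocycle T V E i (\<lambda>x. emb (\<nu> x) x) =
      (\<lambda>x1 x2 x3. coboundary T V \<theta> \<nu> x1 x2 x3 \<oplus>\<^bsub>V\<^esub> \<omega> x1 x2 x3)"
proof -
  note [simp] = linear_maps_closed[OF \<nu>]
  show sec: "(\<lambda>x. emb (\<nu> x) x) \<in> linear_sections K T E p"
    unfolding linear_sections_def
    by (auto intro!: linear_mapsI simp: emb_add emb_smult linear_maps_add[OF \<nu>] linear_maps_smult[OF \<nu>])
  interpret shifted: lts_extension_section K T V \<theta> E i p "\<lambda>x. emb (\<nu> x) x"
    by unfold_locales (rule sec)
  have emb: "shifted.emb u x = emb (u \<oplus>\<^bsub>V\<^esub> \<nu> x) x" if "u \<in> carrier V" "x \<in> carrier T" for u x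
    using that unfolding shifted.emb_def by (simp add: emb_def i_add E.M.a_assoc)
  show "extension_cocycle T V E i (\<lambda>x. emb (\<nu> x) x) =
      (\<lambda>x1 x2 x3. coboundary T V \<theta> \<nu> x1 x2 x3 \<oplus>\<^bsub>V\<^esub> \<omega> x1 x2 x3)"
  proof (intro ext)
    fix x1 x2 x3
    show "shifted.\<omega> x1 x2 x3 = coboundary T V \<theta> \<nu> x1 x2 x3 \<oplus>\<^bsub>V\<^esub> \<omega> x1 x2 x3"
    proof (cases "x1 \<in> carrier T \<and> x2 \<in> carrier T \<and> x3 \<in> carrier T")
      case True
      then have [simp]: "x1 \<in> carrier T" "x2 \<in> carrier T" "x3 \<in> carrier T" by auto
      let ?s = "semidirect_bracket (\<nu> x1) x1 (\<nu> x2) x2 (\<nu> x3) x3" and ?n = "\<nu> (tbracket T x1 x2 x3)"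
      \<comment> \<open>Coordinates \<open>(u, x)\<close> for the shifted section are
        \<open>(u + \<nu> x, x)\<close> for \<open>\<sigma>\<close>. So the claimed value plus
        \<open>?n\<close> must be the first coordinate \<open>?s + \<omega> x1 x2 x3\<close> of the
        bracket of the shifted lifts, and indeed the two occurrences of \<open>?n\<close>
        cancel.\<close>
      have "?s \<ominus>\<^bsub>V\<^esub> ?n \<oplus>\<^bsub>V\<^esub> \<omega> x1 x2 x3 \<oplus>\<^bsub>V\<^esub> ?n = ?s \<oplus>\<^bsub>V\<^esub> \<omega> x1 x2 x3 \<oplus>\<^bsub>V\<^esub> (?n \<oplus>\<^bsub>V\<^esub> \<ominus>\<^bsub>V\<^esub> ?n)"
        by (simp add: a_minus_def V.M.a_ac)
      also have "\<dots> = ?s \<oplus>\<^bsub>V\<^esub> \<omega> x1 x2 x3" by (simp add: V.M.r_neg)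
      finally show ?thesis
        by (intro shifted.omega_eqI[where y = "tbracket T x1 x2 x3"])
          (simp_all add: coboundary_eq[OF \<nu>] bracket_emb emb)
    qed (auto simp: extension_cocycle_def coboundary_def)
  qed
qed

lemma other_section:
  assumes "\<tau> \<in> linear_sections K T E p"
  obtains \<nu> where "\<nu> \<in> linear_maps K T V"
    "extension_cocycle T V E i \<tau> = (\<lambda>x1 x2 x3. coboundary T V \<theta> \<nu> x1 x2 x3 \<oplus>\<^bsub>V\<^esub> \<omega> x1 x2 x3)"
proof -
  have lin: "\<tau> \<in> linear_maps K T E" and p: "\<And>x. x \<in> carrier T \<Longrightarrow> p (\<tau> x) = x"
    using assms by (auto simp: linear_sections_def)
  define \<nu> where "\<nu> = (\<lambda>x. vpart (\<tau> x))"
  have "\<nu> \<in> linear_maps K T V" unfolding \<nu>_def by (rule linear_maps_compose[OF lin vpart_linear])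
  moreover have "emb (\<nu> x) x = \<tau> x" if "x \<in> carrier T" for x
    using emb_vpart[of "\<tau> x"] linear_maps_closed[OF lin] p that by (simp add: \<nu>_def)
  \<comment> \<open>\<open>\<tau>\<close> and the shifted section need only agree on
    \<open>carrier T\<close>; the cocycles are nevertheless equal as functions, since they only
    evaluate a section there and are zero elsewhere.\<close>
  then have "extension_cocycle T V E i \<tau> = extension_cocycle T V E i (\<lambda>x. emb (\<nu> x) x)"
    by (intro ext) (simp add: extension_cocycle_def)
  ultimately show ?thesis using shifted_section(2) that by simp
qed

end

text \<open>\<open>F\<close> takes coordinates for \<open>\<sigma>\<close> to the same coordinates
  for the composite section and preserves brackets, so the bracket of the lifts has the same first
  coordinate on both sides. \<open>E\<close> and \<open>E'\<close> may have different element types,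
  which is needed for transport into \<open>'e\<close>.\<close>

lemma extension_cocycle_hom:
  assumes "lts_extension_section K T V \<theta> E i p \<sigma>" and "lts_abelian_extension K T V \<theta> E' j q"
    and F: "F \<in> lts_hom K E E'" "\<And>v. v \<in> carrier V \<Longrightarrow> F (i v) = j v"
    "\<And>x. x \<in> carrier E \<Longrightarrow> q (F x) = p x"
  shows "(\<lambda>x. F (\<sigma> x)) \<in> linear_sections K T E' q"
    and "extension_cocycle T V E' j (\<lambda>x. F (\<sigma> x)) = extension_cocycle T V E i \<sigma>"
proof -
  interpret E: lts_extension_section K T V \<theta> E i p \<sigma> by fact
  interpret E': lts_abelian_extension K T V \<theta> E' j q by fact
  have lin: "F \<in> linear_maps K E E'" using F(1) by (simp add: lts_hom_def)
  note [simp] = linear_maps_closed[OF lin] F(3)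
  show sec: "(\<lambda>x. F (\<sigma> x)) \<in> linear_sections K T E' q"
    using linear_maps_compose[OF E.s_linear lin] by (simp add: linear_sections_def)
  interpret E'': lts_extension_section K T V \<theta> E' j q "\<lambda>x. F (\<sigma> x)"
    by unfold_locales (rule sec)
  have emb: "F (E.emb u x) = E''.emb u x" if "u \<in> carrier V" "x \<in> carrier T" for u x
    using that by (simp add: E.emb_def E''.emb_def linear_maps_add[OF lin] F(2))
  show "E''.\<omega> = E.\<omega>"
  proof (intro ext)
    fix x1 x2 x3
    show "E''.\<omega> x1 x2 x3 = E.\<omega> x1 x2 x3"
    proof (cases "x1 \<in> carrier T \<and> x2 \<in> carrier T \<and> x3 \<in> carrier T")
      case True
      then have x: "x1 \<in> carrier T" "x2 \<in> carrier T" "x3 \<in> carrier T" by auto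
      have "tbracket E' (F (\<sigma> x1)) (F (\<sigma> x2)) (F (\<sigma> x3)) = F (tbracket E (\<sigma> x1) (\<sigma> x2) (\<sigma> x3))"
        using F(1) x by (simp add: lts_hom_def)
      also have "\<dots> = E''.emb (E.\<omega> x1 x2 x3) (tbracket T x1 x2 x3)"
        using x by (simp add: E.bracket_s emb)
      finally show ?thesis using x by (intro E''.omega_eqI) auto
    qed (auto simp: extension_cocycle_def)
  qed
qed

text \<open>The morphism sends an element of \<open>E\<close> to the element of \<open>E'\<close>
  with the same coordinates. By \<open>bracket_emb\<close> the bracket in coordinates depends on the
  extension only through its cocycle, so it is preserved.\<close>

lemma extension_equivI:
  assumes "lts_extension_section K T V \<theta> E i p \<sigma>" and "lts_extension_section K T V \<theta> E' j q \<tau>"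
    and eq: "extension_cocycle T V E i \<sigma> = extension_cocycle T V E' j \<tau>"
  shows "((E, i, p), (E', j, q)) \<in> extension_equiv K T V \<theta>"
proof -
  interpret E: lts_extension_section K T V \<theta> E i p \<sigma> by fact
  interpret E': lts_extension_section K T V \<theta> E' j q \<tau> by fact
  define F where "F = (\<lambda>a. E'.emb (E.vpart a) (p a))"
  have lin: "F \<in> linear_maps K E E'"
    unfolding F_def
    by (rule linear_mapsI) (simp_all add: linear_maps_add[OF E.vpart_linear]
        linear_maps_smult[OF E.vpart_linear] E.p_add E.p_smult E'.emb_add E'.emb_smult)
  have emb: "F (E.emb u x) = E'.emb u x" if "u \<in> carrier V" "x \<in> carrier T" for u x
    using that by (simp add: F_def)
  have "F (tbracket E a b c) = tbracket E' (F a) (F b) (F c)"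
    if "a \<in> carrier E" "b \<in> carrier E" "c \<in> carrier E" for a b c
  proof -
    have "F (tbracket E (E.emb (E.vpart a) (p a)) (E.emb (E.vpart b) (p b)) (E.emb (E.vpart c) (p c)))
      = tbracket E' (F a) (F b) (F c)"
      using that by (subst E.bracket_emb) (simp_all add: emb F_def E'.bracket_emb eq)
    then show ?thesis using that by (simp add: E.emb_vpart)
  qed
  then have "F \<in> lts_hom K E E'" using lin by (simp add: lts_hom_def)
  moreover have "F (i v) = j v" if "v \<in> carrier V" for v
  proof -
    have "E.emb v \<zero>\<^bsub>T\<^esub> = i v" "E'.emb v \<zero>\<^bsub>T\<^esub> = j v"
      using that by (simp_all add: E.emb_def E'.emb_def)
    then show ?thesis using emb[OF that, of "\<zero>\<^bsub>T\<^esub>"] by simp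
  qed
  moreover have "q (F a) = p a" if "a \<in> carrier E" for a
    using that by (simp add: F_def)
  ultimately show ?thesis
    using E.abelian_extension E'.abelian_extension by (auto simp: extension_equiv_def)
qed

section \<open>The coset of an extension\<close>

context lts_representation
begin

text \<open>The arguments are arbitrary, by the convention that a cocycle is zero off the carrier.
  This allows identities between cocycles to be proved as equations of functions.\<close>

lemma cocycle_closed: "\<omega> \<in> cocycles3 K T V \<theta> \<Longrightarrow> \<omega> x1 x2 x3 \<in> carrier V"
proof (cases "x1 \<in> carrier T \<and> x2 \<in> carrier T \<and> x3 \<in> carrier T")
  case True
  assume "\<omega> \<in> cocycles3 K T V \<theta>"
  then have "(\<lambda>x. \<omega> x x2 x3) \<in> linear_maps K T V"
    using True by (simp add: cocycles3_def trilinear_maps_def)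
  then show ?thesis using linear_maps_closed True by fastforce
next
  case False
  assume "\<omega> \<in> cocycles3 K T V \<theta>"
  then have "\<omega> x1 x2 x3 = \<zero>\<^bsub>V\<^esub>" using False unfolding cocycles3_def by blast
  then show ?thesis by simp
qed

lemma coboundary_closed:
  assumes "\<nu> \<in> linear_maps K T V"
  shows "coboundary T V \<theta> \<nu> x1 x2 x3 \<in> carrier V"
proof (cases "x1 \<in> carrier T \<and> x2 \<in> carrier T \<and> x3 \<in> carrier T")
  case True
  then show ?thesis using linear_maps_closed[OF assms] by (simp add: coboundary_eq[OF assms])
qed (auto simp: coboundary_def)

lemma coboundary_add:
  assumes "\<mu> \<in> linear_maps K T V" "\<nu> \<in> linear_maps K T V"
  shows "coboundary T V \<theta> (\<lambda>x. \<mu> x \<oplus>\<^bsub>V\<^esub> \<nu> x) x1 x2 x3 =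
    coboundary T V \<theta> \<mu> x1 x2 x3 \<oplus>\<^bsub>V\<^esub> coboundary T V \<theta> \<nu> x1 x2 x3"
proof (cases "x1 \<in> carrier T \<and> x2 \<in> carrier T \<and> x3 \<in> carrier T")
  case True
  then show ?thesis
    using linear_maps_closed[OF assms(1)] linear_maps_closed[OF assms(2)]
      linear_maps_sum[OF module_axioms V.module_axioms assms]
    by (simp add: coboundary_eq assms semidirect_bracket_add a_minus_def V.M.minus_add V.M.add4)
qed (auto simp: coboundary_def)

lemma coboundary_uminus:
  assumes "\<nu> \<in> linear_maps K T V"
  shows "coboundary T V \<theta> (\<lambda>x. \<ominus>\<^bsub>V\<^esub> \<nu> x) x1 x2 x3 = \<ominus>\<^bsub>V\<^esub> coboundary T V \<theta> \<nu> x1 x2 x3"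
proof (cases "x1 \<in> carrier T \<and> x2 \<in> carrier T \<and> x3 \<in> carrier T")
  case True
  then show ?thesis
    using linear_maps_closed[OF assms]
    by (simp add: coboundary_def a_minus_def V.M.minus_add rep.minus D.minus)
qed (auto simp: coboundary_def V.M.a_inv_zero)

lemma coboundary_zero: "coboundary T V \<theta> (\<lambda>x. \<zero>\<^bsub>V\<^esub>) x1 x2 x3 = \<zero>\<^bsub>V\<^esub>"
  by (auto simp: coboundary_def a_minus_def V.M.a_inv_zero)

lemma linear_maps_const_zero: "(\<lambda>x. \<zero>\<^bsub>V\<^esub>) \<in> linear_maps K T V"
  by (rule linear_mapsI) auto

text \<open>The explicit form in which cosets are handled from here on: a member of the coset of
  \<open>\<omega>\<close> is given by a linear map \<open>\<nu>\<close>.\<close>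

lemma coset_eq:
  "coboundaries3 K T V \<theta> #>\<^bsub>cocycle_group K T V \<theta>\<^esub> \<omega> =
   {\<lambda>x1 x2 x3. coboundary T V \<theta> \<nu> x1 x2 x3 \<oplus>\<^bsub>V\<^esub> \<omega> x1 x2 x3 | \<nu>. \<nu> \<in> linear_maps K T V}"
  by (auto simp: r_coset_def coboundaries3_def cocycle_group_def)

lemma mem_coset_self:
  assumes "\<omega> \<in> cocycles3 K T V \<theta>"
  shows "\<omega> \<in> coboundaries3 K T V \<theta> #>\<^bsub>cocycle_group K T V \<theta>\<^esub> \<omega>"
  unfolding coset_eq
  using linear_maps_const_zero cocycle_closed[OF assms]
  by (intro CollectI exI[of _ "\<lambda>x. \<zero>\<^bsub>V\<^esub>"]) (simp add: coboundary_zero)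

text \<open>Since \<open>d\<close> is additive, \<open>d\<mu> + (d\<nu> + \<omega>)\<close> is given
  by \<open>\<mu> + \<nu>\<close> in the coset of \<open>\<omega>\<close>; conversely
  \<open>d\<mu> + \<omega>\<close> is given by \<open>\<mu> - \<nu>\<close> in the coset of
  \<open>d\<nu> + \<omega>\<close>.\<close>

lemma coset_shift:
  assumes "\<nu> \<in> linear_maps K T V" "\<omega> \<in> cocycles3 K T V \<theta>"
  shows "coboundaries3 K T V \<theta> #>\<^bsub>cocycle_group K T V \<theta>\<^esub>
      (\<lambda>x1 x2 x3. coboundary T V \<theta> \<nu> x1 x2 x3 \<oplus>\<^bsub>V\<^esub> \<omega> x1 x2 x3) =
    coboundaries3 K T V \<theta> #>\<^bsub>cocycle_group K T V \<theta>\<^esub> \<omega>"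
proof -
  have sum: "(\<lambda>x1 x2 x3. coboundary T V \<theta> \<mu> x1 x2 x3 \<oplus>\<^bsub>V\<^esub>
      (coboundary T V \<theta> \<nu> x1 x2 x3 \<oplus>\<^bsub>V\<^esub> \<omega> x1 x2 x3)) =
    (\<lambda>x1 x2 x3. coboundary T V \<theta> (\<lambda>x. \<mu> x \<oplus>\<^bsub>V\<^esub> \<nu> x) x1 x2 x3 \<oplus>\<^bsub>V\<^esub> \<omega> x1 x2 x3)"
    if "\<mu> \<in> linear_maps K T V" for \<mu>
    using that assms by (simp add: coboundary_add coboundary_closed cocycle_closed V.M.a_assoc)
  have diff: "(\<lambda>x1 x2 x3. coboundary T V \<theta> \<mu> x1 x2 x3 \<oplus>\<^bsub>V\<^esub> \<omega> x1 x2 x3) =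
    (\<lambda>x1 x2 x3. coboundary T V \<theta> (\<lambda>x. \<mu> x \<oplus>\<^bsub>V\<^esub> \<ominus>\<^bsub>V\<^esub> \<nu> x) x1 x2 x3 \<oplus>\<^bsub>V\<^esub>
      (coboundary T V \<theta> \<nu> x1 x2 x3 \<oplus>\<^bsub>V\<^esub> \<omega> x1 x2 x3))"
    if "\<mu> \<in> linear_maps K T V" for \<mu>
    using that assms linear_maps_uminus[OF module_axioms V.module_axioms assms(1)]
    by (simp add: coboundary_add coboundary_uminus coboundary_closed cocycle_closed V.M.a_assoc
        V.M.r_neg1)
  note lin = linear_maps_sum[OF module_axioms V.module_axioms _ assms(1)]
    linear_maps_sum[OF module_axioms V.module_axioms _
      linear_maps_uminus[OF module_axioms V.module_axioms assms(1)]]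
  show ?thesis
    unfolding coset_eq
  proof (intro equalityI subsetI; elim CollectE exE conjE)
    fix \<omega>' \<mu> assume \<mu>: "\<mu> \<in> linear_maps K T V"
    {
      assume "\<omega>' = (\<lambda>x1 x2 x3. coboundary T V \<theta> \<mu> x1 x2 x3 \<oplus>\<^bsub>V\<^esub>
        (coboundary T V \<theta> \<nu> x1 x2 x3 \<oplus>\<^bsub>V\<^esub> \<omega> x1 x2 x3))"
      then show "\<omega>' \<in> {\<lambda>x1 x2 x3. coboundary T V \<theta> \<nu> x1 x2 x3 \<oplus>\<^bsub>V\<^esub> \<omega> x1 x2 x3 | \<nu>.
          \<nu> \<in> linear_maps K T V}"
        using lin(1)[OF \<mu>] sum[OF \<mu>] by (intro CollectI exI conjI) simp_all
    next
      assume "\<omega>' = (\<lambda>x1 x2 x3. coboundary T V \<theta> \<mu> x1 x2 x3 \<oplus>\<^bsub>V\<^esub> \<omega> x1 x2 x3)"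
      then show "\<omega>' \<in> {\<lambda>x1 x2 x3. coboundary T V \<theta> \<mu> x1 x2 x3 \<oplus>\<^bsub>V\<^esub>
          (coboundary T V \<theta> \<nu> x1 x2 x3 \<oplus>\<^bsub>V\<^esub> \<omega> x1 x2 x3) | \<mu>. \<mu> \<in> linear_maps K T V}"
        using lin(2)[OF \<mu>] diff[OF \<mu>] by (intro CollectI exI conjI) simp_all
    }
  qed
qed

end

context lts_extension_section
begin

lemma coset_other_section:
  assumes "\<tau> \<in> linear_sections K T E p"
  shows "coboundaries3 K T V \<theta> #>\<^bsub>cocycle_group K T V \<theta>\<^esub> extension_cocycle T V E i \<tau> =
    coboundaries3 K T V \<theta> #>\<^bsub>cocycle_group K T V \<theta>\<^esub> \<omega>"
proof -
  obtain \<nu> where "\<nu> \<in> linear_maps K T V"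
    "extension_cocycle T V E i \<tau> = (\<lambda>x1 x2 x3. coboundary T V \<theta> \<nu> x1 x2 x3 \<oplus>\<^bsub>V\<^esub> \<omega> x1 x2 x3)"
    using other_section[OF assms] .
  then show ?thesis using coset_shift[OF _ omega_cocycle] by simp
qed

end

lemma (in lts_abelian_extension) exists_section:
  assumes "field K"
  shows "\<exists>\<sigma>. lts_extension_section K T V \<theta> E i p \<sigma>"
proof -
  obtain \<sigma> where "\<sigma> \<in> linear_maps K T E" "\<forall>x\<in>carrier T. p (\<sigma> x) = x"
    using exists_linear_section[OF assms E.module_axioms module_axioms p_linear p_image] by blast
  then have "lts_extension_section K T V \<theta> E i p \<sigma>"
    by unfold_locales (simp add: linear_sections_def)
  then show ?thesis by blast
qed

text \<open>The right-hand side is plainly an equivalence relation in the extensions; this is how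
  the one-directional definition of equivalence becomes usable for a quotient.\<close>

lemma extension_equiv_iff_coset_eq:
  assumes "field K" and "lts_extension_section K T V \<theta> E i p \<sigma>"
    and "lts_extension_section K T V \<theta> E' j q \<tau>"
  shows "((E, i, p), (E', j, q)) \<in> extension_equiv K T V \<theta> \<longleftrightarrow>
    coboundaries3 K T V \<theta> #>\<^bsub>cocycle_group K T V \<theta>\<^esub> extension_cocycle T V E i \<sigma> =
    coboundaries3 K T V \<theta> #>\<^bsub>cocycle_group K T V \<theta>\<^esub> extension_cocycle T V E' j \<tau>"
proof -
  interpret E: lts_extension_section K T V \<theta> E i p \<sigma> by fact
  interpret E': lts_extension_section K T V \<theta> E' j q \<tau> by fact
  show ?thesis
  proof
    assume "((E, i, p), (E', j, q)) \<in> extension_equiv K T V \<theta>"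
    then obtain F where F: "F \<in> lts_hom K E E'" "\<And>v. v \<in> carrier V \<Longrightarrow> F (i v) = j v"
      "\<And>x. x \<in> carrier E \<Longrightarrow> q (F x) = p x"
      by (auto simp: extension_equiv_def)
    note hom = extension_cocycle_hom[OF assms(2) E'.lts_abelian_extension_axioms F]
    show "coboundaries3 K T V \<theta> #>\<^bsub>cocycle_group K T V \<theta>\<^esub> E.\<omega> =
      coboundaries3 K T V \<theta> #>\<^bsub>cocycle_group K T V \<theta>\<^esub> E'.\<omega>"
      using E'.coset_other_section[OF hom(1)] hom(2) by simp
  next
    assume "coboundaries3 K T V \<theta> #>\<^bsub>cocycle_group K T V \<theta>\<^esub> E.\<omega> =
      coboundaries3 K T V \<theta> #>\<^bsub>cocycle_group K T V \<theta>\<^esub> E'.\<omega>"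
    then have "E.\<omega> \<in> coboundaries3 K T V \<theta> #>\<^bsub>cocycle_group K T V \<theta>\<^esub> E'.\<omega>"
      using E.mem_coset_self[OF E.omega_cocycle] by simp
    then obtain \<nu> where \<nu>: "\<nu> \<in> linear_maps K T V"
      and eq: "E.\<omega> = (\<lambda>x1 x2 x3. coboundary T V \<theta> \<nu> x1 x2 x3 \<oplus>\<^bsub>V\<^esub> E'.\<omega> x1 x2 x3)"
      by (auto simp: E.coset_eq)
    \<comment> \<open>The difference \<open>d\<nu>\<close> of the cocycles is absorbed into the
      section of \<open>E'\<close>; after that the two cocycles are equal and the coordinate map is
      a morphism.\<close>
    note shifted = E'.shifted_section[OF \<nu>]
    have "lts_extension_section K T V \<theta> E' j q (\<lambda>x. E'.emb (\<nu> x) x)"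
      by unfold_locales (rule shifted(1))
    then show "((E, i, p), (E', j, q)) \<in> extension_equiv K T V \<theta>"
      using extension_equivI[OF assms(2)] shifted(2) eq by simp
  qed
qed


section \<open>The extension defined by a cocycle\<close>

text \<open>The semidirect product with its bracket twisted by \<open>\<omega>\<close>. The
  \<open>V\<close>-part is written out because \<open>semidirect_bracket\<close> belongs to the
  locale of representations; \<open>twisted_lts_bracket\<close> restores that form.\<close>

definition twisted_lts ::
  "('k, 't, 'n) lts_scheme \<Rightarrow> ('k, 'v, 'l) module_scheme \<Rightarrow> ('t \<Rightarrow> 't \<Rightarrow> 'v \<Rightarrow> 'v) \<Rightarrow>
   ('t \<Rightarrow> 't \<Rightarrow> 't \<Rightarrow> 'v) \<Rightarrow> ('k, 'v \<times> 't) lts" where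
  "twisted_lts T V \<theta> \<omega> =
     \<lparr>carrier = carrier V \<times> carrier T, monoid.mult = (\<lambda>a b. a), one = (\<zero>\<^bsub>V\<^esub>, \<zero>\<^bsub>T\<^esub>),
      ring.zero = (\<zero>\<^bsub>V\<^esub>, \<zero>\<^bsub>T\<^esub>),
      ring.add = (\<lambda>a b. (fst a \<oplus>\<^bsub>V\<^esub> fst b, snd a \<oplus>\<^bsub>T\<^esub> snd b)),
      smult = (\<lambda>k a. (k \<odot>\<^bsub>V\<^esub> fst a, k \<odot>\<^bsub>T\<^esub> snd a)),
      tbracket = (\<lambda>a b c.
        (\<theta> (snd b) (snd c) (fst a) \<ominus>\<^bsub>V\<^esub> \<theta> (snd a) (snd c) (fst b) \<oplus>\<^bsub>V\<^esub>
           rep_D V \<theta> (snd a) (snd b) (fst c) \<oplus>\<^bsub>V\<^esub> \<omega> (snd a) (snd b) (snd c),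
         tbracket T (snd a) (snd b) (snd c)))\<rparr>"

lemma twisted_lts_simps [simp]:
  "carrier (twisted_lts T V \<theta> \<omega>) = carrier V \<times> carrier T"
  "\<zero>\<^bsub>twisted_lts T V \<theta> \<omega>\<^esub> = (\<zero>\<^bsub>V\<^esub>, \<zero>\<^bsub>T\<^esub>)"
  "(u, x) \<oplus>\<^bsub>twisted_lts T V \<theta> \<omega>\<^esub> (v, y) = (u \<oplus>\<^bsub>V\<^esub> v, x \<oplus>\<^bsub>T\<^esub> y)"
  "k \<odot>\<^bsub>twisted_lts T V \<theta> \<omega>\<^esub> (u, x) = (k \<odot>\<^bsub>V\<^esub> u, k \<odot>\<^bsub>T\<^esub> x)"
  by (simp_all add: twisted_lts_def)

context lts_representation
begin

lemma twisted_lts_bracket [simp]: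
  "tbracket (twisted_lts T V \<theta> \<omega>) (u1, x1) (u2, x2) (u3, x3) =
     (semidirect_bracket u1 x1 u2 x2 u3 x3 \<oplus>\<^bsub>V\<^esub> \<omega> x1 x2 x3, tbracket T x1 x2 x3)"
  by (simp add: twisted_lts_def semidirect_bracket_def)

lemma twisted_lts_module: "module K (twisted_lts T V \<theta> \<omega>)"
proof (rule moduleI)
  show "cring K" by unfold_locales
  show "abelian_group (twisted_lts T V \<theta> \<omega>)"
  proof (rule abelian_groupI)
    fix a assume "a \<in> carrier (twisted_lts T V \<theta> \<omega>)"
    then obtain u x where "a = (u, x)" "u \<in> carrier V" "x \<in> carrier T" by auto
    then show "\<exists>b\<in>carrier (twisted_lts T V \<theta> \<omega>). b \<oplus>\<^bsub>twisted_lts T V \<theta> \<omega>\<^esub> a = \<zero>\<^bsub>twisted_lts T V \<theta> \<omega>\<^esub>"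
      by (intro bexI[of _ "(\<ominus>\<^bsub>V\<^esub> u, \<ominus>\<^bsub>T\<^esub> x)"]) (auto simp: V.M.l_neg M.l_neg)
  qed (auto simp: V.M.a_ac M.a_ac)
qed (auto simp: V.smult_l_distr V.smult_r_distr V.smult_assoc1 smult_l_distr smult_r_distr smult_assoc1)

lemma twisted_lts_lie_triple_system:
  assumes \<omega>: "\<omega> \<in> cocycles3 K T V \<theta>"
  shows "lie_triple_system K (twisted_lts T V \<theta> \<omega>)" (is "lie_triple_system K ?E")
proof -
  have tri: "\<omega> \<in> trilinear_maps K T T T V" using \<omega> by (simp add: cocycles3_def)
  interpret \<omega>: trilinear_map K T T T V \<omega> by unfold_locales (rule tri)
  interpret E: module K ?E by (rule twisted_lts_module)
  show ?thesis
  proof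
    show "tbracket ?E \<in> trilinear_maps K ?E ?E ?E ?E"
    proof (intro trilinear_mapsI linear_mapsI)
      fix a a' b c assume "a \<in> carrier ?E" "a' \<in> carrier ?E" "b \<in> carrier ?E" "c \<in> carrier ?E"
      then obtain u x u' x' v y w z where
        [simp]: "a = (u, x)" "a' = (u', x')" "b = (v, y)" "c = (w, z)"
          "u \<in> carrier V" "u' \<in> carrier V" "v \<in> carrier V" "w \<in> carrier V"
          "x \<in> carrier T" "x' \<in> carrier T" "y \<in> carrier T" "z \<in> carrier T"
        by auto
      show "tbracket ?E (a \<oplus>\<^bsub>?E\<^esub> a') b c = tbracket ?E a b c \<oplus>\<^bsub>?E\<^esub> tbracket ?E a' b c"
        "tbracket ?E b (a \<oplus>\<^bsub>?E\<^esub> a') c = tbracket ?E b a c \<oplus>\<^bsub>?E\<^esub> tbracket ?E b a' c"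
        "tbracket ?E b c (a \<oplus>\<^bsub>?E\<^esub> a') = tbracket ?E b c a \<oplus>\<^bsub>?E\<^esub> tbracket ?E b c a'"
        by (simp_all add: semidirect_bracket_add_slot bracket.add \<omega>.add V.M.add4)
    next
      fix k a b c assume "k \<in> carrier K" "a \<in> carrier ?E" "b \<in> carrier ?E" "c \<in> carrier ?E"
      then obtain u x v y w z where
        [simp]: "k \<in> carrier K" "a = (u, x)" "b = (v, y)" "c = (w, z)"
          "u \<in> carrier V" "v \<in> carrier V" "w \<in> carrier V"
          "x \<in> carrier T" "y \<in> carrier T" "z \<in> carrier T"
        by auto
      show "tbracket ?E (k \<odot>\<^bsub>?E\<^esub> a) b c = k \<odot>\<^bsub>?E\<^esub> tbracket ?E a b c"
        "tbracket ?E b (k \<odot>\<^bsub>?E\<^esub> a) c = k \<odot>\<^bsub>?E\<^esub> tbracket ?E b a c"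
        "tbracket ?E b c (k \<odot>\<^bsub>?E\<^esub> a) = k \<odot>\<^bsub>?E\<^esub> tbracket ?E b c a"
        by (simp_all add: semidirect_bracket_smult bracket.smult \<omega>.smult V.smult_r_distr)
    qed auto
    show "tbracket ?E a a b = \<zero>\<^bsub>?E\<^esub>" if "a \<in> carrier ?E" "b \<in> carrier ?E" for a b
      using that \<omega> by (auto simp: semidirect_bracket_alt tbracket_alt cocycles3_def)
    show "tbracket ?E a b c \<oplus>\<^bsub>?E\<^esub> tbracket ?E b c a \<oplus>\<^bsub>?E\<^esub> tbracket ?E c a b = \<zero>\<^bsub>?E\<^esub>"
      if "a \<in> carrier ?E" "b \<in> carrier ?E" "c \<in> carrier ?E" for a b c
    proof -
      obtain u1 x1 u2 x2 u3 x3 where abc: "a = (u1, x1)" "b = (u2, x2)" "c = (u3, x3)"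
        by (cases a, cases b, cases c)
      then have [simp]: "u1 \<in> carrier V" "u2 \<in> carrier V" "u3 \<in> carrier V"
        "x1 \<in> carrier T" "x2 \<in> carrier T" "x3 \<in> carrier T" using that by auto
      have "\<omega> x1 x2 x3 \<oplus>\<^bsub>V\<^esub> \<omega> x2 x3 x1 \<oplus>\<^bsub>V\<^esub> \<omega> x3 x1 x2 = \<zero>\<^bsub>V\<^esub>"
        using \<omega> by (simp add: cocycles3_def)
      \<comment> \<open>Regrouping separates the cyclic sum of the semidirect bracket from that of
        \<open>\<omega>\<close>; each vanishes by itself.\<close>
      moreover have "semidirect_bracket u1 x1 u2 x2 u3 x3 \<oplus>\<^bsub>V\<^esub> \<omega> x1 x2 x3 \<oplus>\<^bsub>V\<^esub>
          (semidirect_bracket u2 x2 u3 x3 u1 x1 \<oplus>\<^bsub>V\<^esub> \<omega> x2 x3 x1) \<oplus>\<^bsub>V\<^esub>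
          (semidirect_bracket u3 x3 u1 x1 u2 x2 \<oplus>\<^bsub>V\<^esub> \<omega> x3 x1 x2) =
        (semidirect_bracket u1 x1 u2 x2 u3 x3 \<oplus>\<^bsub>V\<^esub> semidirect_bracket u2 x2 u3 x3 u1 x1 \<oplus>\<^bsub>V\<^esub>
          semidirect_bracket u3 x3 u1 x1 u2 x2) \<oplus>\<^bsub>V\<^esub>
        (\<omega> x1 x2 x3 \<oplus>\<^bsub>V\<^esub> \<omega> x2 x3 x1 \<oplus>\<^bsub>V\<^esub> \<omega> x3 x1 x2)"
        by (simp add: V.M.a_ac)
      ultimately show ?thesis
        by (simp add: abc tbracket_cyclic semidirect_bracket_cyclic)
    qed
    show "tbracket ?E a b (tbracket ?E c d e) =
        tbracket ?E (tbracket ?E a b c) d e \<oplus>\<^bsub>?E\<^esub> tbracket ?E c (tbracket ?E a b d) e \<oplus>\<^bsub>?E\<^esub>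
        tbracket ?E c d (tbracket ?E a b e)"
      if "a \<in> carrier ?E" "b \<in> carrier ?E" "c \<in> carrier ?E" "d \<in> carrier ?E" "e \<in> carrier ?E"
      for a b c d e
    proof -
      obtain u1 x1 u2 x2 v1 y1 v2 y2 v3 y3 where abc: "a = (u1, x1)" "b = (u2, x2)"
        "c = (v1, y1)" "d = (v2, y2)" "e = (v3, y3)"
        by (cases a, cases b, cases c, cases d, cases e)
      then have [simp]: "u1 \<in> carrier V" "u2 \<in> carrier V" "v1 \<in> carrier V" "v2 \<in> carrier V"
        "v3 \<in> carrier V" "x1 \<in> carrier T" "x2 \<in> carrier T" "y1 \<in> carrier T" "y2 \<in> carrier T"
        "y3 \<in> carrier T" using that by auto
      let ?L = "semidirect_bracket u1 x1 u2 x2 (semidirect_bracket v1 y1 v2 y2 v3 y3) (tbracket T y1 y2 y3)"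
      let ?A = "semidirect_bracket (semidirect_bracket u1 x1 u2 x2 v1 y1) (tbracket T x1 x2 y1) v2 y2 v3 y3"
      let ?B = "semidirect_bracket v1 y1 (semidirect_bracket u1 x1 u2 x2 v2 y2) (tbracket T x1 x2 y2) v3 y3"
      let ?C = "semidirect_bracket v1 y1 v2 y2 (semidirect_bracket u1 x1 u2 x2 v3 y3) (tbracket T x1 x2 y3)"
      have "\<omega> x1 x2 (tbracket T y1 y2 y3) \<oplus>\<^bsub>V\<^esub> D x1 x2 (\<omega> y1 y2 y3) =
             \<omega> (tbracket T x1 x2 y1) y2 y3 \<oplus>\<^bsub>V\<^esub>
             \<omega> y1 (tbracket T x1 x2 y2) y3 \<oplus>\<^bsub>V\<^esub>
             \<omega> y1 y2 (tbracket T x1 x2 y3) \<oplus>\<^bsub>V\<^esub>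
             \<theta> y2 y3 (\<omega> x1 x2 y1) \<ominus>\<^bsub>V\<^esub>
             \<theta> y1 y3 (\<omega> x1 x2 y2) \<oplus>\<^bsub>V\<^esub>
             D y1 y2 (\<omega> x1 x2 y3)" (is "?P = ?Q")
        using \<omega> by (simp add: cocycles3_def)
      moreover have "?L = ?A \<oplus>\<^bsub>V\<^esub> ?B \<oplus>\<^bsub>V\<^esub> ?C"
        by (rule semidirect_bracket_derivation) simp_all
      \<comment> \<open>The \<open>V\<close>-part of the derivation identity is the semidirect one
        plus the cocycle identity. The two regroupings that follow recognize its sides: each
        \<open>\<theta>\<close> or \<open>D\<close> term of \<open>?P\<close> and \<open>?Q\<close>
        comes from an inner value of \<open>\<omega>\<close> in a slot of the outer bracket.\<close>
      ultimately have "?L \<oplus>\<^bsub>V\<^esub> ?P = (?A \<oplus>\<^bsub>V\<^esub> ?B \<oplus>\<^bsub>V\<^esub> ?C) \<oplus>\<^bsub>V\<^esub> ?Q"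
        by (simp only:)
      moreover have "?L \<oplus>\<^bsub>V\<^esub> ?P = semidirect_bracket u1 x1 u2 x2
          (semidirect_bracket v1 y1 v2 y2 v3 y3 \<oplus>\<^bsub>V\<^esub> \<omega> y1 y2 y3) (tbracket T y1 y2 y3) \<oplus>\<^bsub>V\<^esub>
          \<omega> x1 x2 (tbracket T y1 y2 y3)"
        by (simp add: semidirect_bracket_slot) (simp add: V.M.a_ac)
      moreover have "(?A \<oplus>\<^bsub>V\<^esub> ?B \<oplus>\<^bsub>V\<^esub> ?C) \<oplus>\<^bsub>V\<^esub> ?Q =
        (semidirect_bracket (semidirect_bracket u1 x1 u2 x2 v1 y1 \<oplus>\<^bsub>V\<^esub> \<omega> x1 x2 y1)
           (tbracket T x1 x2 y1) v2 y2 v3 y3 \<oplus>\<^bsub>V\<^esub> \<omega> (tbracket T x1 x2 y1) y2 y3) \<oplus>\<^bsub>V\<^esub>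
        (semidirect_bracket v1 y1 (semidirect_bracket u1 x1 u2 x2 v2 y2 \<oplus>\<^bsub>V\<^esub> \<omega> x1 x2 y2)
           (tbracket T x1 x2 y2) v3 y3 \<oplus>\<^bsub>V\<^esub> \<omega> y1 (tbracket T x1 x2 y2) y3) \<oplus>\<^bsub>V\<^esub>
        (semidirect_bracket v1 y1 v2 y2 (semidirect_bracket u1 x1 u2 x2 v3 y3 \<oplus>\<^bsub>V\<^esub> \<omega> x1 x2 y3)
           (tbracket T x1 x2 y3) \<oplus>\<^bsub>V\<^esub> \<omega> y1 y2 (tbracket T x1 x2 y3))"
        by (simp add: semidirect_bracket_slot a_minus_def) (simp add: V.M.a_ac)
      ultimately show ?thesis
        using tbracket_derivation[of x1 x2 y1 y2 y3] by (simp add: abc)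
    qed
  qed
qed

end

lemma zero_bracket_lts_simps:
  "\<zero>\<^bsub>zero_bracket_lts V\<^esub> = \<zero>\<^bsub>V\<^esub>"
  "x \<oplus>\<^bsub>zero_bracket_lts V\<^esub> y = x \<oplus>\<^bsub>V\<^esub> y"
  "k \<odot>\<^bsub>zero_bracket_lts V\<^esub> x = k \<odot>\<^bsub>V\<^esub> x"
  "tbracket (zero_bracket_lts V) x y z = \<zero>\<^bsub>V\<^esub>"
  by (simp_all add: zero_bracket_lts_def)

lemma (in module) zero_bracket_lts_lie_triple_system:
  "lie_triple_system R (zero_bracket_lts M)" (is "lie_triple_system R ?W")
proof -
  have grp: "abelian_group ?W"
  proof (rule abelian_groupI)
    fix x assume "x \<in> carrier ?W"
    then show "\<exists>y\<in>carrier ?W. y \<oplus>\<^bsub>?W\<^esub> x = \<zero>\<^bsub>?W\<^esub>"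
      by (intro bexI[of _ "\<ominus>\<^bsub>M\<^esub> x"]) (simp_all add: zero_bracket_lts_simps M.l_neg)
  qed (simp_all add: zero_bracket_lts_simps M.a_ac)
  have cring: "cring R" by unfold_locales
  have "module R ?W"
    by (rule moduleI[OF cring grp])
      (simp_all add: zero_bracket_lts_simps smult_l_distr smult_r_distr smult_assoc1)
  then interpret W: module R ?W .
  show ?thesis
    by unfold_locales
      (simp_all add: zero_bracket_lts_simps trilinear_maps_def linear_maps_def)
qed

context lts_representation
begin

text \<open>In a bracket of elements \<open>(\<zero>, x)\<close> the semidirect part vanishes and
  only \<open>\<omega>\<close> is left. Thus the obvious section recovers exactly
  \<open>\<omega>\<close>, not merely its class.\<close>

lemma twisted_lts_extension:
  assumes \<omega>: "\<omega> \<in> cocycles3 K T V \<theta>"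
  shows "lts_extension_section K T V \<theta> (twisted_lts T V \<theta> \<omega>) (\<lambda>v. (v, \<zero>\<^bsub>T\<^esub>)) snd (\<lambda>x. (\<zero>\<^bsub>V\<^esub>, x))"
    and "extension_cocycle T V (twisted_lts T V \<theta> \<omega>) (\<lambda>v. (v, \<zero>\<^bsub>T\<^esub>)) (\<lambda>x. (\<zero>\<^bsub>V\<^esub>, x)) = \<omega>"
proof -
  let ?E = "twisted_lts T V \<theta> \<omega>" and ?i = "\<lambda>v. (v, \<zero>\<^bsub>T\<^esub>)" and ?s = "\<lambda>x. (\<zero>\<^bsub>V\<^esub>, x)"
  have tri: "\<omega> \<in> trilinear_maps K T T T V" using \<omega> by (simp add: cocycles3_def)
  interpret \<omega>: trilinear_map K T T T V \<omega> by unfold_locales (rule tri)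
  have E: "lie_triple_system K ?E" by (rule twisted_lts_lie_triple_system[OF \<omega>])
  have sd: "semidirect_bracket u1 x1 u2 x2 u3 x3 = \<theta> x2 x3 u1 \<oplus>\<^bsub>V\<^esub> \<ominus>\<^bsub>V\<^esub> \<theta> x1 x3 u2 \<oplus>\<^bsub>V\<^esub> D x1 x2 u3"
    for u1 x1 u2 x2 u3 x3 by (simp add: semidirect_bracket_def a_minus_def)
  have i_hom: "?i \<in> lts_hom K (zero_bracket_lts V) ?E"
    unfolding lts_hom_def
    by (auto intro!: linear_mapsI simp: zero_bracket_lts_simps sd V.M.a_inv_zero)
  have p_hom: "snd \<in> lts_hom K ?E T"
    unfolding lts_hom_def by (auto intro!: linear_mapsI)
  have "lts_extension K (zero_bracket_lts V) ?E T ?i snd"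
    unfolding lts_extension_def
    using V.zero_bracket_lts_lie_triple_system E lie_triple_system_axioms i_hom p_hom
    by (auto simp: inj_on_def)
  then have abelian: "(?E, ?i, snd) \<in> abelian_extensions K T V \<theta>"
    by (auto simp: abelian_extensions_def sd V.M.a_inv_zero)
  have sec: "?s \<in> linear_sections K T ?E snd"
    by (auto simp: linear_sections_def intro!: linear_mapsI)
  show *: "lts_extension_section K T V \<theta> ?E ?i snd ?s"
    by unfold_locales (rule abelian, rule sec)
  interpret S: lts_extension_section K T V \<theta> ?E ?i snd ?s by (rule *)
  show "S.\<omega> = \<omega>"
  proof (intro ext)
    fix x1 x2 x3
    show "S.\<omega> x1 x2 x3 = \<omega> x1 x2 x3"
    proof (cases "x1 \<in> carrier T \<and> x2 \<in> carrier T \<and> x3 \<in> carrier T")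
      case True
      then show ?thesis
        by (intro S.omega_eqI[where y = "tbracket T x1 x2 x3"])
          (simp_all add: S.emb_def sd V.M.a_inv_zero)
    next
      case False
      then have "\<omega> x1 x2 x3 = \<zero>\<^bsub>V\<^esub>" using \<omega> unfolding cocycles3_def by blast
      then show ?thesis using False by (auto simp: extension_cocycle_def)
    qed
  qed
qed

end


section \<open>Transport along an injection\<close>

text \<open>Structure carried along \<open>g\<close>, injective on the carrier, to its image;
  \<open>h\<close> is the inverse on that image. It brings the extension built on pairs into the
  type on which the classes are formed.\<close>

definition transport_lts :: "('a \<Rightarrow> 'e) \<Rightarrow> ('k, 'a) lts \<Rightarrow> ('k, 'e) lts" where
  "transport_lts g E =
     (let h = inv_into (carrier E) g in
       \<lparr>carrier = g ` carrier E, monoid.mult = (\<lambda>a b. a), one = g \<zero>\<^bsub>E\<^esub>,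
        ring.zero = g \<zero>\<^bsub>E\<^esub>, ring.add = (\<lambda>a b. g (h a \<oplus>\<^bsub>E\<^esub> h b)),
        smult = (\<lambda>k a. g (k \<odot>\<^bsub>E\<^esub> h a)),
        tbracket = (\<lambda>a b c. g (tbracket E (h a) (h b) (h c)))\<rparr>)"

lemma transport_lts_simps:
  "carrier (transport_lts g E) = g ` carrier E"
  "\<zero>\<^bsub>transport_lts g E\<^esub> = g \<zero>\<^bsub>E\<^esub>"
  "inj_on g (carrier E) \<Longrightarrow> x \<in> carrier E \<Longrightarrow> y \<in> carrier E \<Longrightarrow>
    g x \<oplus>\<^bsub>transport_lts g E\<^esub> g y = g (x \<oplus>\<^bsub>E\<^esub> y)"
  "inj_on g (carrier E) \<Longrightarrow> x \<in> carrier E \<Longrightarrow> k \<odot>\<^bsub>transport_lts g E\<^esub> g x = g (k \<odot>\<^bsub>E\<^esub> x)"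
  "inj_on g (carrier E) \<Longrightarrow> x \<in> carrier E \<Longrightarrow> y \<in> carrier E \<Longrightarrow> z \<in> carrier E \<Longrightarrow>
    tbracket (transport_lts g E) (g x) (g y) (g z) = g (tbracket E x y z)"
  by (simp_all add: transport_lts_def Let_def)

lemma transport_lts_lie_triple_system:
  fixes E :: "('k, 'a) lts"
  assumes "lie_triple_system K E" and inj: "inj_on g (carrier E)"
  shows "lie_triple_system K (transport_lts g E)" (is "lie_triple_system K ?F")
proof -
  interpret lie_triple_system K E by fact
  note [simp] = transport_lts_simps(1,2) transport_lts_simps(3-)[OF inj]
  have grp: "abelian_group ?F"
  proof (rule abelian_groupI)
    fix a assume "a \<in> carrier ?F"
    then obtain x where "a = g x" "x \<in> carrier E" by auto
    then show "\<exists>y\<in>carrier ?F. y \<oplus>\<^bsub>?F\<^esub> a = \<zero>\<^bsub>?F\<^esub>"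
      by (intro bexI[of _ "g (\<ominus>\<^bsub>E\<^esub> x)"]) (simp_all add: M.l_neg)
  qed (auto simp: M.a_ac)
  have cring: "cring K" by unfold_locales
  have "module K ?F"
    by (rule moduleI[OF cring grp]) (auto simp: smult_l_distr smult_r_distr smult_assoc1)
  then interpret F: module K ?F .
  show ?thesis
  proof
    show "tbracket ?F \<in> trilinear_maps K ?F ?F ?F ?F"
      by (intro trilinear_mapsI linear_mapsI) (auto simp: bracket.add bracket.smult)
  next
    fix a b assume "a \<in> carrier ?F" "b \<in> carrier ?F"
    then show "tbracket ?F a a b = \<zero>\<^bsub>?F\<^esub>" by (auto simp: tbracket_alt)
  next
    fix a b c assume "a \<in> carrier ?F" "b \<in> carrier ?F" "c \<in> carrier ?F"
    then show "tbracket ?F a b c \<oplus>\<^bsub>?F\<^esub> tbracket ?F b c a \<oplus>\<^bsub>?F\<^esub> tbracket ?F c a b = \<zero>\<^bsub>?F\<^esub>"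
      by (auto simp: tbracket_cyclic)
  next
    fix a b c d e
    assume "a \<in> carrier ?F" "b \<in> carrier ?F" "c \<in> carrier ?F" "d \<in> carrier ?F" "e \<in> carrier ?F"
    then obtain x1 x2 y1 y2 y3 where [simp]: "a = g x1" "b = g x2" "c = g y1" "d = g y2" "e = g y3"
      "x1 \<in> carrier E" "x2 \<in> carrier E" "y1 \<in> carrier E" "y2 \<in> carrier E" "y3 \<in> carrier E"
      by auto
    show "tbracket ?F a b (tbracket ?F c d e) =
        tbracket ?F (tbracket ?F a b c) d e \<oplus>\<^bsub>?F\<^esub> tbracket ?F c (tbracket ?F a b d) e \<oplus>\<^bsub>?F\<^esub>
        tbracket ?F c d (tbracket ?F a b e)"
      by (simp add: tbracket_derivation[of x1 x2 y1 y2 y3])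
  qed
qed

text \<open>The second claim makes \<open>g\<close> a morphism of extensions, so
  \<open>extension_cocycle_hom\<close> applies and the copy has the cocycle of the original.\<close>

lemma (in lts_abelian_extension) transport_extension:
  assumes inj: "inj_on g (carrier E)"
  shows "(transport_lts g E, \<lambda>v. g (i v), \<lambda>a. p (inv_into (carrier E) g a)) \<in> abelian_extensions K T V \<theta>"
    and "g \<in> lts_hom K E (transport_lts g E)"
proof -
  let ?F = "transport_lts g E" and ?q = "\<lambda>a. p (inv_into (carrier E) g a)"
  note [simp] = transport_lts_simps(1,2) transport_lts_simps(3-)[OF inj] inj inj_on_eq_iff[OF inj]
  have F: "lie_triple_system K ?F" by (rule transport_lts_lie_triple_system[OF E.lie_triple_system_axioms inj])
  show g: "g \<in> lts_hom K E ?F"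
    unfolding lts_hom_def by (auto intro!: linear_mapsI)
  have i_bracket: "tbracket E (i u) (i v) (i w) = \<zero>\<^bsub>E\<^esub>"
    if "u \<in> carrier V" "v \<in> carrier V" "w \<in> carrier V" for u v w
    using that by (simp add: bracket_i1)
  have "(\<lambda>v. g (i v)) \<in> lts_hom K (zero_bracket_lts V) ?F"
    unfolding lts_hom_def
    by (auto intro!: linear_mapsI simp: zero_bracket_lts_simps i_add i_smult i_bracket)
  moreover have "?q \<in> lts_hom K ?F T"
    unfolding lts_hom_def by (auto intro!: linear_mapsI simp: p_add p_smult p_bracket)
  moreover have "(\<lambda>v. g (i v)) ` carrier V = {x \<in> carrier ?F. ?q x = \<zero>\<^bsub>T\<^esub>}"
  proof -
    have "(\<lambda>v. g (i v)) ` carrier V = g ` (i ` carrier V)" by (simp add: image_image)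
    also have "\<dots> = {x \<in> carrier ?F. ?q x = \<zero>\<^bsub>T\<^esub>}" unfolding i_image by auto
    finally show ?thesis .
  qed
  moreover have "?q ` carrier ?F = carrier T"
    using p_image by (simp add: image_image)
  ultimately have "lts_extension K (zero_bracket_lts V) ?F T (\<lambda>v. g (i v)) ?q"
    unfolding lts_extension_def
    using F V.zero_bracket_lts_lie_triple_system lie_triple_system_axioms
    by (simp add: inj_on_def)
  moreover have "tbracket ?F (g (i u)) (g (i v)) a = \<zero>\<^bsub>?F\<^esub> \<and> tbracket ?F (g (i u)) a (g (i v)) = \<zero>\<^bsub>?F\<^esub> \<and>
      tbracket ?F a (g (i u)) (g (i v)) = \<zero>\<^bsub>?F\<^esub>"
    if "u \<in> carrier V" "v \<in> carrier V" "a \<in> carrier ?F" for u v a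
    using that by (auto simp: bracket_i1 bracket_i2 E.M.a_inv_zero)
  moreover have "tbracket ?F (g (i v)) a b = g (i (\<theta> (?q a) (?q b) v))"
    if "v \<in> carrier V" "a \<in> carrier ?F" "b \<in> carrier ?F" for v a b
    using that by (auto simp: bracket_i1)
  ultimately show "(?F, \<lambda>v. g (i v), ?q) \<in> abelian_extensions K T V \<theta>"
    unfolding abelian_extensions_def by (auto simp del: transport_lts_simps)
qed


section \<open>Classification\<close>

text \<open>The hypothesis says that \<open>r\<close> relates points of \<open>A\<close> with equal
  value of \<open>f\<close>. Hence the classes are the nonempty fibres of \<open>f\<close> on
  \<open>A\<close>, and a fibre is determined by its value.\<close>

lemma bij_betw_quotient_image:
  assumes "\<And>x y. (x, y) \<in> r \<longleftrightarrow> x \<in> A \<and> y \<in> A \<and> f x = f y"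
  shows "\<exists>\<Phi>. bij_betw \<Phi> (A // r) (f ` A) \<and> (\<forall>x\<in>A. \<Phi> (r `` {x}) = f x)"
proof -
  have cls: "r `` {x} = {y \<in> A. f y = f x}" if "x \<in> A" for x
    using that assms by auto
  define \<Phi> where "\<Phi> = (\<lambda>C. f (SOME x. x \<in> C))"
  have val: "\<Phi> (r `` {x}) = f x" if "x \<in> A" for x
    using someI[of "\<lambda>y. y \<in> r `` {x}" x] that by (simp add: \<Phi>_def cls)
  have "bij_betw \<Phi> (A // r) (f ` A)"
  proof (rule bij_betw_imageI)
    show "inj_on \<Phi> (A // r)"
    proof (rule inj_onI)
      fix C D assume "C \<in> A // r" "D \<in> A // r" and eq: "\<Phi> C = \<Phi> D"
      then obtain x y where xy: "C = r `` {x}" "D = r `` {y}" "x \<in> A" "y \<in> A"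
        by (auto elim!: quotientE)
      then have "f x = f y" using eq by (simp add: val)
      then show "C = D" using xy by (simp add: cls)
    qed
    show "\<Phi> ` (A // r) = f ` A"
    proof -
      have "A // r = (\<lambda>x. r `` {x}) ` A" by (auto simp: quotient_def)
      then show ?thesis by (simp add: image_image val)
    qed
  qed
  then show ?thesis using val by blast
qed

theorem theorem4p7:
  fixes K :: "('k, 'm) ring_scheme"
    and T :: "('k, 't, 'n) lts_scheme"
    and V :: "('k, 'v, 'l) module_scheme"
    and \<theta> :: "'t \<Rightarrow> 't \<Rightarrow> 'v \<Rightarrow> 'v"
    and g :: "'v \<times> 't \<Rightarrow> 'e"
  assumes "algebraically_closed K"
    and "ring_characteristic K \<noteq> 2" and "ring_characteristic K \<noteq> 3"
    and "lie_triple_system K T"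
    and "lts_representation K T V \<theta>"
    \<comment> \<open>the type \<open>'e\<close> hosting the extensions is large enough to contain \<open>V \<times> T\<close>\<close>
    and "inj_on g (carrier V \<times> carrier T)"
  shows "\<exists>\<Phi>. bij_betw \<Phi>
        ((abelian_extensions K T V \<theta> :: (('k, 'e) lts \<times> ('v \<Rightarrow> 'e) \<times> ('e \<Rightarrow> 't)) set)
          // extension_equiv K T V \<theta>)
        (carrier (cohomology3 K T V \<theta>)) \<and>
      (\<forall>(E, i, p) \<in> abelian_extensions K T V \<theta>. \<forall>\<sigma> \<in> linear_sections K T E p.
        \<Phi> (extension_equiv K T V \<theta> `` {(E, i, p)}) =
          coboundaries3 K T V \<theta> #>\<^bsub>cocycle_group K T V \<theta>\<^esub> extension_cocycle T V E i \<sigma>)"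
proof -
  interpret lts_representation K T V \<theta> by fact
  interpret L: algebraically_closed K by fact
  have K: "field K" by unfold_locales
  let ?A = "abelian_extensions K T V \<theta> :: (('k, 'e) lts \<times> ('v \<Rightarrow> 'e) \<times> ('e \<Rightarrow> 't)) set"
  let ?coset = "\<lambda>\<omega>. coboundaries3 K T V \<theta> #>\<^bsub>cocycle_group K T V \<theta>\<^esub> \<omega>"
  have abelian: "lts_abelian_extension K T V \<theta> E i p" if "(E, i, p) \<in> ?A" for E i p
    by unfold_locales (rule that)
  have sec: "lts_extension_section K T V \<theta> E i p \<sigma>"
    if "(E, i, p) \<in> ?A" "\<sigma> \<in> linear_sections K T E p" for E i p \<sigma>
    using that by unfold_locales
  \<comment> \<open>An arbitrary section is chosen so that \<open>f\<close> depends on the extension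
    alone; the fact \<open>f\<close> below shows that every linear section gives the same
    coset.\<close>
  define f where "f = (\<lambda>(E :: ('k, 'e) lts, i, p). ?coset (extension_cocycle T V E i
    (SOME \<sigma>. \<sigma> \<in> linear_sections K T E p)))"
  have some: "(SOME \<sigma>. \<sigma> \<in> linear_sections K T E p) \<in> linear_sections K T E p"
    if "(E, i, p) \<in> ?A" for E i p
    using lts_abelian_extension.exists_section[OF abelian[OF that] K]
    by (metis lts_extension_section.linear_section someI_ex)
  have canonical: "lts_extension_section K T V \<theta> E i p (SOME \<sigma>. \<sigma> \<in> linear_sections K T E p)"
    if "(E, i, p) \<in> ?A" for E i p
    by (rule sec[OF that some[OF that]])
  have f: "f (E, i, p) = ?coset (extension_cocycle T V E i \<sigma>)"
    if "(E, i, p) \<in> ?A" "\<sigma> \<in> linear_sections K T E p" for E i p \<sigma>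
    unfolding f_def
    using lts_extension_section.coset_other_section[OF sec[OF that] some[OF that(1)]] by simp
  have equiv_iff: "(a, b) \<in> extension_equiv K T V \<theta> \<longleftrightarrow> a \<in> ?A \<and> b \<in> ?A \<and> f a = f b" for a b
  proof -
    obtain E i p E' j q where ab: "a = (E, i, p)" "b = (E', j, q)" by (metis prod_cases3)
    show ?thesis
    proof (cases "a \<in> ?A \<and> b \<in> ?A")
      case True
      then show ?thesis
        using extension_equiv_iff_coset_eq[OF K canonical canonical]
        by (simp add: ab f_def)
    next
      case False
      then show ?thesis by (auto simp: ab extension_equiv_def)
    qed
  qed
  have image: "f ` ?A = carrier (cohomology3 K T V \<theta>)"
  proof -
    have carrier: "carrier (cohomology3 K T V \<theta>) = ?coset ` cocycles3 K T V \<theta>"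
      by (auto simp: cohomology3_def FactGroup_def RCOSETS_def cocycle_group_def)
    have "f a \<in> ?coset ` cocycles3 K T V \<theta>" if a: "a \<in> ?A" for a
    proof -
      obtain E i p where "a = (E, i, p)" by (metis prod_cases3)
      then show ?thesis
        using lts_extension_section.omega_cocycle[OF canonical] a by (auto simp: f_def)
    qed
    moreover have "?coset \<omega> \<in> f ` ?A" if \<omega>: "\<omega> \<in> cocycles3 K T V \<theta>" for \<omega>
    proof -
      let ?E = "twisted_lts T V \<theta> \<omega>"
      note E = twisted_lts_extension[OF \<omega>]
      interpret E: lts_extension_section K T V \<theta> ?E "\<lambda>v. (v, \<zero>\<^bsub>T\<^esub>)" snd "\<lambda>x. (\<zero>\<^bsub>V\<^esub>, x)"
        by (rule E(1))
      have inj: "inj_on g (carrier ?E)" using assms(6) by simp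
      note F = E.transport_extension[OF inj]
      \<comment> \<open>The lifts \<open>(\<zero>, x)\<close> are sent by \<open>g\<close> to a
        section of the copy, whose cocycle is again \<open>\<omega>\<close>. So the coset of every
        cocycle is attained on the type \<open>'e\<close>.\<close>
      note hom = extension_cocycle_hom[OF E(1) abelian[OF F(1)] F(2)]
      have "f (transport_lts g ?E, \<lambda>v. g (v, \<zero>\<^bsub>T\<^esub>), \<lambda>a. snd (inv_into (carrier ?E) g a)) = ?coset \<omega>"
        using f[OF F(1) hom(1)] hom(2) E(2) inj by simp
      then show ?thesis using imageI[OF F(1), of f] by simp
    qed
    ultimately show ?thesis unfolding carrier by blast
  qed
  obtain \<Phi> where "bij_betw \<Phi> (?A // extension_equiv K T V \<theta>) (f ` ?A)"
    and \<Phi>: "\<forall>a\<in>?A. \<Phi> (extension_equiv K T V \<theta> `` {a}) = f a"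
    using bij_betw_quotient_image[OF equiv_iff] by (elim exE conjE)
  then have "bij_betw \<Phi> (?A // extension_equiv K T V \<theta>) (carrier (cohomology3 K T V \<theta>))"
    unfolding image by simp
  moreover have "\<Phi> (extension_equiv K T V \<theta> `` {(E, i, p)}) = ?coset (extension_cocycle T V E i \<sigma>)"
    if "(E, i, p) \<in> ?A" "\<sigma> \<in> linear_sections K T E p" for E i p \<sigma>
    using bspec[OF \<Phi> that(1)] f[OF that] by simp
  ultimately show ?thesis
    by (intro exI[of _ \<Phi>] conjI) (simp, clarify, simp)
qed

end
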